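(* Let $n\ge2$, $d\ge1$, and let $f$ be a real-valued $\mathcal{C}^d$-smooth function on some open neighbourhood of the unit sphere $S^{n-1}\subset\mathbb{R}^n$ with $\int_{S^{n-1}}f\,d\sigma_{n-1}=0$. Assume that $$\lVert f^{(k)}\rVert_{\mathrm{Op},2}\le n^{-(d-k)/2}\qquad\text{for all }k=1,\dots,d-1,$$ and $|f^{(d)}(\theta)|_{\mathrm{Op}}\le 1$ for all $\theta\in S^{n-1}$. Then $$\int_{S^{n-1}}\exp\Big\{\frac{(n-1)\,|f|^{2/d}}{8e}\Big\}\,d\sigma_{n-1}\le 2.$$
   Context: $S^{n-1}=\{x\in\mathbb{R}^n:|x|=1\}$ and $\sigma_{n-1}$ is the uniform (normalized Lebesgue) probability measure on it. $f^{(k)}(x)$ is the hypermatrix of usual (Euclidean) $k$-th order partial derivatives of $f$ at $x$, viewed as a symmetric $k$-linear form, with $|f^{(k)}(x)|_{\mathrm{Op}}=\sup\{f^{(k)}(x)[v_1,\dots,v_k]:v_j\in\mathbb{R}^n,\ |v_1|=\dots=|v_k|=1\}$, and $\lVert f^{(k)}\rVert_{\mathrm{Op},2}=(\int_{S^{n-1}}|f^{(k)}|_{\mathrm{Op}}^2\,d\sigma_{n-1})^{1/2}$. *)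

theory Defs
  imports "HOL-Analysis.Analysis" "HOL-Probability.Probability_Measure"
begin

text \<open>
  The measure \<open>\<sigma>\<close> on the unit sphere, as the normalized cone measure: a Borel set \<open>A\<close> of
  unit vectors gets the fraction of the volume of the unit ball occupied by the cone
  \<open>{x \<in> ball 0 1 - {0}. x / |x| \<in> A}\<close>. This is normalized surface measure.
  The measure space is the sphere itself, so functions are integrated over the sphere only and
  their values elsewhere are irrelevant.
\<close>

definition sphere_uniform :: "'a::euclidean_space measure" where
  "sphere_uniform =
     restrict_space (distr (uniform_measure lborel (ball 0 1)) borel sgn) (sphere 0 1)"

lemma space_sphere_uniform [simp]: "space sphere_uniform = sphere 0 1"
  by (simp add: sphere_uniform_def space_restrict_space)

lemma sets_sphere_uniform:
  "sets sphere_uniform = sets (restrict_space borel (sphere (0::'a::euclidean_space) 1))"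
  unfolding sphere_uniform_def by (intro sets_restrict_space_cong) simp

lemma emeasure_sphere_uniform:
  fixes A :: "'a::euclidean_space set"
  assumes "A \<in> sets borel" "A \<subseteq> sphere 0 1"
  shows "emeasure sphere_uniform A =
           emeasure lborel (ball 0 1 \<inter> sgn -` A) / emeasure lborel (ball (0::'a) 1)"
proof -
  have "sgn -` A \<in> sets (borel :: 'a measure)"
    using measurable_sets[OF borel_measurable_sgn assms(1)] by simp
  then show ?thesis
    using assms
    by (simp add: sphere_uniform_def emeasure_restrict_space emeasure_distr)
qed

lemma prob_space_sphere_uniform: "prob_space (sphere_uniform :: 'a::euclidean_space measure)"
proof (rule prob_spaceI)
  let ?B = "ball (0::'a) 1"
  have eq: "?B \<inter> sgn -` sphere 0 1 = ?B - {0}"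
    by (auto simp: norm_sgn)
  have "emeasure lborel (?B - {0}) = emeasure lborel ?B"
    by (intro emeasure_Diff_null_set) auto
  moreover have "emeasure lborel ?B \<noteq> 0"
    using content_ball_pos[of 1 "0::'a"] by (auto simp: measure_def)
  moreover have "emeasure lborel ?B \<noteq> \<infinity>"
    using emeasure_lborel_ball_finite[of 0 1] by (metis less_irrefl)
  ultimately show "emeasure (sphere_uniform :: 'a measure) (space sphere_uniform) = 1"
    by (simp add: emeasure_sphere_uniform eq ennreal_divide_self less_top)
qed

lemma sphere_uniform_rotation_invariant:
  fixes T :: "real^'n::{finite,wellorder} \<Rightarrow> real^'n::_"
  assumes T: "orthogonal_transformation T" and A: "A \<in> sets borel" "A \<subseteq> sphere 0 1"
  shows "emeasure sphere_uniform (T ` A) = emeasure sphere_uniform A"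
proof -
  let ?C = "ball 0 1 \<inter> sgn -` A" and ?S = "inv T"
  have lin: "linear T" and inj: "inj T" and surj: "surj T"
    using T orthogonal_transformation_linear orthogonal_transformation_inj
      orthogonal_transformation_surj by blast+
  have norm [simp]: "norm (T x) = norm x" for x
    by (rule orthogonal_transformation_norm[OF T])
  have sgn: "sgn (T x) = T (sgn x)" for x
    by (simp add: sgn_div_norm linear_cmul[OF lin])
  have "linear ?S"
    using orthogonal_transformation_inv[OF T] orthogonal_transformation_linear by blast
  then have S: "?S \<in> borel_measurable borel"
    by (intro borel_measurable_continuous_onI linear_continuous_on linear_conv_bounded_linear[THEN iffD1])
  have TA: "T ` A = ?S -` A"
    using inj surj by (metis bij_betw_def bij_imp_bij_inv bij_vimage_eq_inv_image inv_inv_eq)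
  have TA_borel: "T ` A \<in> sets borel"
    using measurable_sets[OF S A(1)] by (simp add: TA)
  have TA_sphere: "T ` A \<subseteq> sphere 0 1"
    using A(2) by auto
  have C_borel: "?C \<in> sets borel"
    using measurable_sets[OF borel_measurable_sgn A(1)] by simp
  have TC_borel: "ball 0 1 \<inter> sgn -` T ` A \<in> sets borel"
    using measurable_sets[OF borel_measurable_sgn TA_borel] by simp
  have TC: "ball 0 1 \<inter> sgn -` T ` A = T ` ?C"
  proof (intro subset_antisym subsetI)
    fix y assume y: "y \<in> ball 0 1 \<inter> sgn -` T ` A"
    obtain x where x: "y = T x" using surj by (metis surj_def)
    show "y \<in> T ` ?C"
      using y inj by (simp add: x sgn inj_image_mem_iff)
  qed (auto simp: sgn)
  have finC: "?C \<in> lmeasurable"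
    by (rule bounded_set_imp_lmeasurable) (use C_borel in auto)
  have "emeasure lborel (ball 0 1 \<inter> sgn -` T ` A) = emeasure lebesgue (T ` ?C)"
    using TC_borel by (simp add: TC[symmetric])
  also have "\<dots> = emeasure lebesgue ?C"
    using finC measurable_orthogonal_image[OF T finC] measure_orthogonal_image[OF T finC]
    by (simp add: emeasure_eq_measure2)
  also have "\<dots> = emeasure lborel ?C"
    using C_borel by simp
  finally show ?thesis
    using A TA_borel TA_sphere by (simp add: emeasure_sphere_uniform)
qed

text \<open>
  Iterated partial derivatives: \<open>partials [i1, ..., ik] f\<close> is
  \<open>\<partial>\<^sub>i\<^sub>1 (... (\<partial>\<^sub>i\<^sub>k f))\<close>. It is meaningful at the points near which the derivatives exist.
\<close>

primrec partials :: "'n list \<Rightarrow> (real^'n \<Rightarrow> real) \<Rightarrow> real^'n \<Rightarrow> real" where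
  "partials [] f = f"
| "partials (i # is) f = (\<lambda>x. deriv (\<lambda>t. partials is f (x + t *\<^sub>R axis i 1)) 0)"

definition C_smooth_on :: "nat \<Rightarrow> (real^'n \<Rightarrow> real) \<Rightarrow> (real^'n) set \<Rightarrow> bool" where
  "C_smooth_on d f U \<longleftrightarrow>
     (\<forall>is i. length is < d \<longrightarrow>
        (\<forall>x\<in>U. (\<lambda>t. partials is f (x + t *\<^sub>R axis i 1)) field_differentiable (at 0))) \<and>
     (\<forall>is. length is \<le> d \<longrightarrow> continuous_on U (partials is f))"

text \<open>
  The form \<open>f\<^sup>(\<^sup>k\<^sup>)(x)[v\<^sub>1, \<dots>, v\<^sub>k]\<close>; the vectors are \<open>v 0, \<dots>, v (k - 1)\<close>, and the
  other values of \<open>v\<close> do not matter.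
\<close>

definition deriv_form :: "nat \<Rightarrow> (real^'n \<Rightarrow> real) \<Rightarrow> real^'n \<Rightarrow> (nat \<Rightarrow> real^'n) \<Rightarrow> real" where
  "deriv_form k f x v =
     (\<Sum>is | length is = k. partials is f x * (\<Prod>j<k. v j $ (is ! j)))"

definition op_norm :: "nat \<Rightarrow> (real^'n \<Rightarrow> real) \<Rightarrow> real^'n \<Rightarrow> real" where
  "op_norm k f x = Sup {deriv_form k f x v | v. \<forall>j<k. norm (v j) = 1}"

lemma bdd_above_deriv_form:
  "bdd_above {deriv_form k f x v | v. \<forall>j<k. norm (v j) = 1}"
proof (rule bdd_aboveI)
  fix y assume "y \<in> {deriv_form k f x v | v. \<forall>j<k. norm (v j) = 1}"
  then obtain v where v: "\<forall>j<k. norm (v j) = 1" and y: "y = deriv_form k f x v"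
    by blast
  have "partials is f x * (\<Prod>j<k. v j $ (is ! j)) \<le> \<bar>partials is f x\<bar>" for "is"
  proof -
    have "\<bar>\<Prod>j<k. v j $ (is ! j)\<bar> \<le> 1"
      unfolding abs_prod using v
      by (auto intro!: prod_le_1 component_le_norm_cart[THEN order_trans])
    then have "\<bar>partials is f x\<bar> * \<bar>\<Prod>j<k. v j $ (is ! j)\<bar> \<le> \<bar>partials is f x\<bar> * 1"
      by (intro mult_left_mono) auto
    then have "\<bar>partials is f x * (\<Prod>j<k. v j $ (is ! j))\<bar> \<le> \<bar>partials is f x\<bar>"
      by (simp add: abs_mult)
    then show ?thesis
      by (rule order_trans[OF abs_ge_self])
  qed
  then show "y \<le> (\<Sum>is | length is = k. \<bar>partials is f x\<bar>)"
    unfolding y deriv_form_def by (intro sum_mono)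
qed

definition op_norm_L2 :: "nat \<Rightarrow> (real^'n \<Rightarrow> real) \<Rightarrow> real" where
  "op_norm_L2 k f = sqrt (\<integral>x. (op_norm k f x)\<^sup>2 \<partial>sphere_uniform)"

end

theory Submission
  imports Defs
begin

text \<open>
  Let \<open>x\<close>, \<open>v\<close> be independent uniform points of the sphere, \<open>y\<close> the unit tangent vector at \<open>x\<close> pointing
  to \<open>v\<close>, and \<open>t\<close> their angle, so that \<open>v = x cos t + y sin t\<close>. The angle is independent of the frame
  \<open>(x, y)\<close>, whose law is invariant under rotations in its plane, because the orthogonal group acts
  transitively on frames. Hence \<open>F(x) - F(x cos t + y sin t)\<close> has, for a fixed \<open>t\<close>, an \<open>L\<^sup>p\<close> norm of at most
  \<open>t\<close> times that of \<open>\<nabla>F(x) \<bullet> y\<close>, and as the mean of \<open>t\<close> is \<open>\<pi>/2\<close>, a function \<open>F\<close> satisfies for \<open>p = 2m\<close>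
  \<open>\<parallel>F - \<integral>F\<parallel>\<^sub>p \<le> (\<pi>/2) \<parallel>\<nabla>F(x) \<bullet> y\<parallel>\<^sub>p \<le> (\<pi>/2) (m/(n-1))\<^sup>1\<^sup>/\<^sup>2 \<parallel>\<nabla>F\<parallel>\<^sub>p\<close>. This inequality takes the place of the
  logarithmic Sobolev inequality. It is iterated along \<open>F = |f\<^sup>(\<^sup>k\<^sup>)|\<^sub>O\<^sub>p\<close>, which is a uniform limit of soft
  maxima of derivative forms, and whose gradient is bounded by \<open>|f\<^sup>(\<^sup>k\<^sup>+\<^sup>1\<^sup>)|\<^sub>O\<^sub>p\<close>. With
  \<open>T = (\<pi>/2) (m/(n-1))\<^sup>1\<^sup>/\<^sup>2\<close> the result is \<open>\<parallel>f\<parallel>\<^sub>2\<^sub>m \<le> d T\<^sup>d\<close>, and the exponential series converges geometrically.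
\<close>

section \<open>Orthogonal invariance\<close>

text \<open>The difference F(x) - F(v) must not be estimated in L^p as a whole: that would bring in
  the p-th moment of the angle, and (E t^p)^(1/p) tends to pi as p grows, whereas the final
  constants leave room for (pi/2)^2 < 4 but not for pi^2. Only the mean angle enters if the p-th
  moment of u = F - \<integral>F is written as E u(x)^(p-1) (F(x) - F(v)): at a fixed angle t the
  expectation over the frame is bounded linearly in t, by Young's inequality with weight c/t.
  Independence of angle and frame separates t from the rest; it is stated as an equality of
  integrals, without conditional laws.

  The factor d in d T^d counts orders. As n^(-(d-k)/2) <= T^(d-k), the mean of |f^(k)| contributes
  T^(d-k) T^k = T^d for each k = 1, ..., d-1; the bound on f^(d) contributes T^d once more, and
  order 0 nothing, because f has mean zero.

  The constant is 8e = 2 * 4 * e: the k-th moment of |f|^(2/d) is at most (4(k+1)/(n-1))^k, the e is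
  spent on (k+1)^k <= e^k k!, and the 2 makes the ratio of the series 1/2 and its sum 2.\<close>

lemma orthogonal_transformation_borel [measurable_dest]:
  fixes T :: "'a::euclidean_space \<Rightarrow> 'a"
  assumes "orthogonal_transformation T"
  shows "T \<in> borel_measurable borel"
  using assms orthogonal_transformation_linear
  by (intro borel_measurable_continuous_onI linear_continuous_on linear_conv_bounded_linear[THEN iffD1]) blast

lemma nn_integral_lborel_shift:
  fixes f :: "'a::euclidean_space \<Rightarrow> ennreal"
  assumes "f \<in> borel_measurable borel"
  shows "(\<integral>\<^sup>+x. f (c + x) \<partial>lborel) = (\<integral>\<^sup>+x. f x \<partial>lborel)"
  using assms nn_integral_distr[of "(+) c" lborel borel f] by (simp add: lborel_distr_plus)

lemma nn_integral_lborel_reflect: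
  fixes f :: "'a::euclidean_space \<Rightarrow> ennreal"
  assumes [measurable]: "f \<in> borel_measurable borel"
  shows "(\<integral>\<^sup>+x. f (c - x) \<partial>lborel) = (\<integral>\<^sup>+x. f x \<partial>lborel)"
proof -
  have "lborel = distr lborel borel (\<lambda>x::'a. c - x)"
    using lborel_affine[of "-1" c] by (simp add: density_1)
  then have "(\<integral>\<^sup>+x. f x \<partial>lborel) = (\<integral>\<^sup>+x. f x \<partial>distr lborel borel (\<lambda>x::'a. c - x))"
    by simp
  also have "\<dots> = (\<integral>\<^sup>+x. f (c - x) \<partial>lborel)"
    by (rule nn_integral_distr) auto
  finally show ?thesis by simp
qed

text \<open>Uniqueness of a translation invariant measure, by evaluating
  \<open>\<integral>\<integral> 1\<^sub>A (T x) 1\<^sub>B (T x + y) dx dy\<close> in two ways for the unit ball \<open>B\<close>.\<close>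

lemma lborel_distr_orthogonal:
  fixes T :: "'a::euclidean_space \<Rightarrow> 'a"
  assumes T: "orthogonal_transformation T"
  shows "distr lborel borel T = lborel"
proof (rule measure_eqI)
  fix A assume "A \<in> sets (distr lborel borel T)"
  then have A[measurable]: "A \<in> sets borel" by simp
  note [measurable] = orthogonal_transformation_borel[OF T]
  let ?B = "ball (0::'a) 1"
  have [measurable]: "?B \<in> sets borel" by simp
  have lin: "linear T" using T orthogonal_transformation_linear by blast
  have surj: "surj T" using T orthogonal_transformation_surj by blast
  let ?f = "\<lambda>x y. indicator A (T x) * indicator ?B (T x + y) :: ennreal"
  have "(\<integral>\<^sup>+x. \<integral>\<^sup>+y. ?f x y \<partial>lborel \<partial>lborel)
      = (\<integral>\<^sup>+x. indicator A (T x) * emeasure lborel ?B \<partial>lborel)"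
  proof (intro nn_integral_cong)
    fix x
    show "(\<integral>\<^sup>+y. ?f x y \<partial>lborel) = indicator A (T x) * emeasure lborel ?B"
    proof (subst nn_integral_cmult)
      have "(\<integral>\<^sup>+y. indicator ?B (T x + y) \<partial>lborel) = emeasure lborel ?B"
        by (subst nn_integral_lborel_shift) (auto intro!: borel_measurable_indicator)
      then show "indicator A (T x) * (\<integral>\<^sup>+y. indicator ?B (T x + y) \<partial>lborel)
          = indicator A (T x) * emeasure lborel ?B" by simp
    qed measurable
  qed
  also have "\<dots> = emeasure (distr lborel borel T) A * emeasure lborel ?B"
    by (simp add: nn_integral_multc emeasure_distr nn_integral_distr flip: nn_integral_indicator)
  finally have 1: "(\<integral>\<^sup>+x. \<integral>\<^sup>+y. ?f x y \<partial>lborel \<partial>lborel)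
      = emeasure (distr lborel borel T) A * emeasure lborel ?B" .
  \<comment> \<open>Every \<open>y\<close> is some \<open>T c\<close>, so the translation by
    \<open>y\<close> behind \<open>T\<close> is a translation by \<open>c\<close> in front of
    it.\<close>
  have shift: "(\<integral>\<^sup>+x. ?f x y \<partial>lborel) = (\<integral>\<^sup>+x. indicator A (T x - y) * indicator ?B (T x) \<partial>lborel)" for y
  proof -
    obtain c where c: "y = T c" using surj by (metis surj_def)
    show ?thesis
      using nn_integral_lborel_shift[of "\<lambda>x. ?f x y" "- c"]
      by (simp add: c linear_add[OF lin] linear_neg[OF lin] linear_diff[OF lin])
  qed
  have "(\<integral>\<^sup>+x. \<integral>\<^sup>+y. ?f x y \<partial>lborel \<partial>lborel)
      = (\<integral>\<^sup>+y. \<integral>\<^sup>+x. ?f x y \<partial>lborel \<partial>lborel)"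
    by (rule lborel_pair.Fubini'[symmetric]) measurable
  also have "\<dots> = (\<integral>\<^sup>+y. \<integral>\<^sup>+x. indicator A (T x - y) * indicator ?B (T x) \<partial>lborel \<partial>lborel)"
    by (simp add: shift)
  also have "\<dots> = (\<integral>\<^sup>+x. \<integral>\<^sup>+y. indicator A (T x - y) * indicator ?B (T x) \<partial>lborel \<partial>lborel)"
    by (rule lborel_pair.Fubini') measurable
  also have "\<dots> = (\<integral>\<^sup>+x. emeasure lborel A * indicator ?B (T x) \<partial>lborel)"
  proof (intro nn_integral_cong)
    fix x
    show "(\<integral>\<^sup>+y. indicator A (T x - y) * indicator ?B (T x) \<partial>lborel)
        = emeasure lborel A * indicator ?B (T x)"
    proof (subst nn_integral_multc)
      have "(\<integral>\<^sup>+y. indicator A (T x - y) \<partial>lborel) = emeasure lborel A"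
        by (subst nn_integral_lborel_reflect) (auto intro!: borel_measurable_indicator)
      then show "(\<integral>\<^sup>+y. indicator A (T x - y) \<partial>lborel) * indicator ?B (T x)
          = emeasure lborel A * indicator ?B (T x)" by simp
    qed measurable
  qed
  \<comment> \<open>\<open>T\<close> preserves the ball, so both evaluations end with the same
    finite nonzero factor, which then cancels.\<close>
  also have "\<dots> = emeasure lborel A * emeasure lborel ?B"
  proof -
    have "(\<integral>\<^sup>+x. indicator ?B (T x) \<partial>lborel) = (\<integral>\<^sup>+x. indicator ?B x \<partial>lborel)"
      using T by (intro nn_integral_cong) (simp add: indicator_def orthogonal_transformation_norm)
    then show ?thesis by (simp add: nn_integral_cmult)
  qed
  finally have "emeasure (distr lborel borel T) A * emeasure lborel ?B = emeasure lborel A * emeasure lborel ?B"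
    using 1 by simp
  moreover have "emeasure lborel ?B \<noteq> 0"
    using content_ball_pos[of 1 "0::'a"] by (auto simp: measure_def)
  moreover have "emeasure lborel ?B \<noteq> \<infinity>"
    using emeasure_lborel_ball_finite[of 0 1] by (metis less_irrefl)
  ultimately show "emeasure (distr lborel borel T) A = emeasure lborel A"
    by (simp add: ennreal_mult_cancel_left mult.commute[of _ "emeasure lborel ?B"])
qed simp

section \<open>Transport of integrals on the sphere and on pairs of points\<close>

lemma measurable_sphere_uniform_borel:
  "(\<lambda>x. x) \<in> sphere_uniform \<rightarrow>\<^sub>M borel"
  unfolding measurable_cong_sets[OF sets_sphere_uniform refl]
  by (rule measurable_restrict_space1) simp

lemma borel_measurable_sphere_uniform [measurable (raw)]:
  "f \<in> M \<rightarrow>\<^sub>M sphere_uniform \<Longrightarrow> f \<in> borel_measurable M"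
  using measurable_compose[OF _ measurable_sphere_uniform_borel] by blast

lemma borel_measurable_continuous_on_sphere:
  fixes f :: "'a::euclidean_space \<Rightarrow> 'b::topological_space"
  assumes "continuous_on (sphere 0 1) f"
  shows "f \<in> borel_measurable sphere_uniform"
  unfolding measurable_cong_sets[OF sets_sphere_uniform refl]
  by (rule borel_measurable_continuous_on_restrict[OF assms])

lemma orthogonal_measurable_sphere_uniform:
  fixes T :: "'a::euclidean_space \<Rightarrow> 'a"
  assumes T: "orthogonal_transformation T"
  shows "T \<in> sphere_uniform \<rightarrow>\<^sub>M sphere_uniform"
proof -
  note [measurable] = orthogonal_transformation_borel[OF T]
  have "T \<in> sphere_uniform \<rightarrow>\<^sub>M restrict_space borel (sphere 0 1)"
    using T by (intro measurable_restrict_space2) (auto simp: orthogonal_transformation_norm)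
  then show ?thesis
    by (simp add: measurable_cong_sets[OF refl sets_sphere_uniform])
qed

text \<open>\<open>sgn\<close> commutes with \<open>T\<close>, so the cone over the preimage of
  \<open>A\<close> is the preimage of the cone over \<open>A\<close>, and Lebesgue measure is
  invariant. The invariance proved with the definitions concerns well-ordered index types; this
  version covers every Euclidean space and, as an equality of measures, transports
  integrals.\<close>

lemma sphere_uniform_distr_orthogonal:
  fixes T :: "'a::euclidean_space \<Rightarrow> 'a"
  assumes T: "orthogonal_transformation T"
  shows "distr sphere_uniform sphere_uniform T = sphere_uniform"
proof (rule measure_eqI)
  note [measurable] = orthogonal_transformation_borel[OF T] orthogonal_measurable_sphere_uniform[OF T]
  have lin: "linear T" using T orthogonal_transformation_linear by blast
  have norm [simp]: "norm (T x) = norm x" for x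
    by (rule orthogonal_transformation_norm[OF T])
  have sgn: "sgn (T x) = T (sgn x)" for x
    by (simp add: sgn_div_norm linear_cmul[OF lin])
  fix A assume "A \<in> sets (distr sphere_uniform sphere_uniform T)"
  then have "A \<in> sets (restrict_space borel (sphere (0::'a) 1))"
    by (simp add: sets_sphere_uniform)
  then have A[measurable]: "A \<in> sets borel" "A \<subseteq> sphere 0 1"
    by (auto simp: sets_restrict_space_iff)
  let ?C = "ball 0 1 \<inter> sgn -` A"
  have C[measurable]: "?C \<in> sets borel"
    using measurable_sets[OF borel_measurable_sgn A(1)] by simp
  have TA: "T -` A \<in> sets borel"
    using measurable_sets[OF orthogonal_transformation_borel[OF T] A(1)] by simp
  have TAs: "T -` A \<subseteq> sphere 0 1"
    using A(2) by (force simp: subset_iff)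
  have "emeasure (distr sphere_uniform sphere_uniform T) A = emeasure sphere_uniform (T -` A)"
    using A TAs by (subst emeasure_distr) (auto simp: sets_sphere_uniform sets_restrict_space_iff Int_absorb2)
  also have "\<dots> = emeasure lborel (ball 0 1 \<inter> sgn -` T -` A) / emeasure lborel (ball (0::'a) 1)"
    using TA TAs by (rule emeasure_sphere_uniform)
  also have "ball 0 1 \<inter> sgn -` T -` A = T -` ?C"
    by (auto simp: sgn)
  also have "emeasure lborel (T -` ?C) = emeasure (distr lborel borel T) ?C"
    by (simp add: emeasure_distr)
  also have "\<dots> = emeasure lborel ?C"
    by (simp add: lborel_distr_orthogonal[OF T])
  also have "\<dots> / emeasure lborel (ball (0::'a) 1) = emeasure sphere_uniform A"
    using A by (simp add: emeasure_sphere_uniform)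
  finally show "emeasure (distr sphere_uniform sphere_uniform T) A = emeasure sphere_uniform A" .
qed simp

interpretation sphere_uniform: prob_space "sphere_uniform :: 'a::euclidean_space measure"
  by (rule prob_space_sphere_uniform)

interpretation sphere_pair: pair_prob_space
  "sphere_uniform :: 'a::euclidean_space measure" "sphere_uniform :: 'b::euclidean_space measure" ..

lemma sphere_pair_distr_orthogonal:
  fixes T :: "'a::euclidean_space \<Rightarrow> 'a"
  assumes T: "orthogonal_transformation T"
  shows "distr (sphere_uniform \<Otimes>\<^sub>M sphere_uniform) (sphere_uniform \<Otimes>\<^sub>M sphere_uniform)
           (\<lambda>(x, y). (T x, T y)) = sphere_uniform \<Otimes>\<^sub>M sphere_uniform"
  using pair_measure_distr[OF orthogonal_measurable_sphere_uniform[OF T] orthogonal_measurable_sphere_uniform[OF T]]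
  by (simp add: sphere_uniform_distr_orthogonal[OF T] sphere_uniform.sigma_finite_measure_axioms)

lemma integral_sphere_orthogonal:
  fixes T :: "'a::euclidean_space \<Rightarrow> 'a" and f :: "'a \<Rightarrow> real"
  assumes T: "orthogonal_transformation T" and f: "f \<in> borel_measurable sphere_uniform"
  shows "(\<integral>x. f (T x) \<partial>sphere_uniform) = (\<integral>x. f x \<partial>sphere_uniform)"
  using integral_distr[OF orthogonal_measurable_sphere_uniform[OF T] f]
  by (simp add: sphere_uniform_distr_orthogonal[OF T])

lemma integral_sphere_pair_orthogonal:
  fixes T :: "'a::euclidean_space \<Rightarrow> 'a" and f :: "'a \<times> 'a \<Rightarrow> real"
  assumes T: "orthogonal_transformation T"
    and f: "f \<in> borel_measurable (sphere_uniform \<Otimes>\<^sub>M sphere_uniform)"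
  shows "(\<integral>p. f (T (fst p), T (snd p)) \<partial>(sphere_uniform \<Otimes>\<^sub>M sphere_uniform))
       = (\<integral>p. f p \<partial>(sphere_uniform \<Otimes>\<^sub>M sphere_uniform))"
proof -
  note [measurable] = orthogonal_measurable_sphere_uniform[OF T]
  have "(\<lambda>(x, y). (T x, T y)) \<in> sphere_uniform \<Otimes>\<^sub>M sphere_uniform \<rightarrow>\<^sub>M sphere_uniform \<Otimes>\<^sub>M sphere_uniform"
    by measurable
  from integral_distr[OF this f] show ?thesis
    by (simp add: sphere_pair_distr_orthogonal[OF T] case_prod_beta)
qed

text \<open>The cone over \<open>S \<inter> sphere 0 1\<close> stays inside \<open>S\<close>, which
  is Lebesgue null. Applied to a line, it excludes the pairs of points that determine no tangent
  direction.\<close>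

lemma sphere_uniform_lowdim_null:
  fixes S :: "'a::euclidean_space set"
  assumes S: "subspace S" "dim S < DIM('a)"
  shows "AE x in sphere_uniform. x \<notin> S"
proof -
  have cl: "closed S" using S closed_subspace by blast
  let ?A = "S \<inter> sphere 0 1"
  have A: "?A \<in> sets borel" using cl by (intro borel_closed) auto
  have "ball 0 1 \<inter> sgn -` ?A \<subseteq> S"
  proof
    fix x assume "x \<in> ball 0 1 \<inter> sgn -` ?A"
    then have "norm x *\<^sub>R sgn x \<in> S" using S(1) by (auto intro: subspace_scale)
    then show "x \<in> S" by (cases "x = 0") (auto simp: sgn_div_norm)
  qed
  moreover have "S \<in> null_sets lborel"
    using negligible_lowdim[OF S(2)] cl
    by (simp add: null_sets_def negligible_iff_null_sets)
  moreover have "ball 0 1 \<inter> sgn -` ?A \<in> sets borel"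
    using measurable_sets[OF borel_measurable_sgn A] by simp
  ultimately have "emeasure lborel (ball 0 1 \<inter> sgn -` ?A) = 0"
    by (metis null_setsD1 null_sets_subset sets_lborel)
  then have "emeasure sphere_uniform ?A = 0"
    using A by (simp add: emeasure_sphere_uniform)
  moreover have "?A \<in> sets sphere_uniform"
    using A by (simp add: sets_sphere_uniform sets_restrict_space_iff)
  ultimately show ?thesis
    by (intro AE_I[of _ _ ?A]) auto
qed

section \<open>Averaging over a transitive family of isometries\<close>

lemma Fubini_bounded:
  fixes f :: "'m \<Rightarrow> 'k \<Rightarrow> real"
  assumes "prob_space M" "prob_space N"
    and f: "(\<lambda>(x, y). f x y) \<in> borel_measurable (M \<Otimes>\<^sub>M N)"
    and B: "\<And>x y. x \<in> space M \<Longrightarrow> y \<in> space N \<Longrightarrow> \<bar>f x y\<bar> \<le> B"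
  shows "(\<integral>x. (\<integral>y. f x y \<partial>N) \<partial>M) = (\<integral>y. (\<integral>x. f x y \<partial>M) \<partial>N)"
proof -
  interpret M: prob_space M by fact
  interpret N: prob_space N by fact
  interpret MN: pair_prob_space M N ..
  have "integrable (M \<Otimes>\<^sub>M N) (\<lambda>(x, y). f x y)"
    by (rule MN.P.integrable_const_bound[of _ B])
       (use f B in \<open>auto simp: space_pair_measure\<close>)
  then show ?thesis by (rule MN.Fubini_integral[symmetric])
qed

text \<open>Both sides are compared with a double integral against the kernel
  \<open>1{dist (Q \<omega>) (Q' \<omega>') < e}\<close>, whose mass does not depend on the base point.\<close>

lemma integral_transitive_average:
  fixes Q :: "'m \<Rightarrow> 's::{second_countable_topology,metric_space}" and Q' :: "'k \<Rightarrow> 's"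
    and g :: "'m \<Rightarrow> 's \<Rightarrow> real"
  defines "k \<equiv> \<lambda>e z w. if dist z w < (e::real) then 1 else 0 :: real"
  assumes M: "prob_space M" and N: "prob_space N"
    and Q[measurable]: "Q \<in> borel_measurable M" and Q'[measurable]: "Q' \<in> borel_measurable N"
    and K: "\<And>\<omega>. \<omega> \<in> space M \<Longrightarrow> Q \<omega> \<in> K" "\<And>\<omega>. \<omega> \<in> space N \<Longrightarrow> Q' \<omega> \<in> K"
    and S: "compact S" "S \<subseteq> K" and QS: "AE \<omega> in M. Q \<omega> \<in> S" and QS': "AE \<omega>' in N. Q' \<omega>' \<in> S"
    and meas[measurable]: "(\<lambda>\<omega>. g \<omega> (Q \<omega>)) \<in> borel_measurable M"
      "(\<lambda>(\<omega>, \<omega>'). g \<omega> (Q' \<omega>')) \<in> borel_measurable (M \<Otimes>\<^sub>M N)"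
      "\<And>y. (\<lambda>\<omega>. g \<omega> y) \<in> borel_measurable M"
    and bounded: "\<And>\<omega> y. \<omega> \<in> space M \<Longrightarrow> y \<in> K \<Longrightarrow> \<bar>g \<omega> y\<bar> \<le> B"
    and ucont: "\<And>\<delta>. \<delta> > 0 \<Longrightarrow> \<exists>e>0. \<forall>\<omega>\<in>space M. \<forall>y\<in>K. \<forall>y'\<in>K. dist y y' < e \<longrightarrow> \<bar>g \<omega> y - g \<omega> y'\<bar> \<le> \<delta>"
    and invN: "\<And>e z z'. z \<in> S \<Longrightarrow> z' \<in> S \<Longrightarrow>
      (\<integral>\<omega>'. k e z (Q' \<omega>') \<partial>N) = (\<integral>\<omega>'. k e z' (Q' \<omega>') \<partial>N)"
    and invM: "\<And>e y z z'. y \<in> S \<Longrightarrow> z \<in> S \<Longrightarrow> z' \<in> S \<Longrightarrow>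
      (\<integral>\<omega>. g \<omega> y * k e (Q \<omega>) z \<partial>M) = (\<integral>\<omega>. g \<omega> y * k e (Q \<omega>) z' \<partial>M)"
  shows "(\<integral>\<omega>. g \<omega> (Q \<omega>) \<partial>M) = (\<integral>\<omega>. (\<integral>\<omega>'. g \<omega> (Q' \<omega>') \<partial>N) \<partial>M)"
proof -
  interpret M: prob_space M by (rule M)
  interpret N: prob_space N by (rule N)
  have k[measurable]: "(\<lambda>x. k e (f x) (h x)) \<in> borel_measurable L"
    if [measurable]: "f \<in> borel_measurable L" "h \<in> borel_measurable L"
    for e L and f h :: "'z \<Rightarrow> 's"
    unfolding k_def by measurable
  have k01: "0 \<le> k e z w" "k e z w \<le> 1" for e z w
    by (auto simp: k_def)
  have "S \<noteq> {}" using QS M.AE_False by auto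
  then obtain z0 where z0: "z0 \<in> S" by blast
  obtain \<omega>0 where "\<omega>0 \<in> space M" using M.not_empty by blast
  then have B0: "0 \<le> B" using bounded[of \<omega>0 z0] z0 S by fastforce
  have gk: "\<bar>g \<omega> y * k e z w\<bar> \<le> B" if "\<omega> \<in> space M" "y \<in> K" for \<omega> y e z w
    using mult_mono[OF bounded[OF that] k01(2)[of e z w] B0 k01(1)] k01[of e z w] by (simp add: abs_mult)
  define a where "a = (\<integral>\<omega>. g \<omega> (Q \<omega>) \<partial>M)"
  define b where "b = (\<integral>\<omega>. (\<integral>\<omega>'. g \<omega> (Q' \<omega>') \<partial>N) \<partial>M)"
  have ba: "b = (\<integral>\<omega>'. (\<integral>\<omega>. g \<omega> (Q' \<omega>') \<partial>M) \<partial>N)"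
    unfolding b_def by (rule Fubini_bounded[OF M N, of _ B]) (use bounded K in auto)
  have intN: "integrable N (\<lambda>\<omega>'. h \<omega>' * k e (f \<omega>') (Q' \<omega>'))"
    if "h \<in> borel_measurable N" "f \<in> borel_measurable N" "\<And>\<omega>'. \<omega>' \<in> space N \<Longrightarrow> \<bar>h \<omega>'\<bar> \<le> C" for h f e C
  proof (rule N.integrable_const_bound[of _ C])
    show "(\<lambda>\<omega>'. h \<omega>' * k e (f \<omega>') (Q' \<omega>')) \<in> borel_measurable N" using that by measurable
    show "AE \<omega>' in N. norm (h \<omega>' * k e (f \<omega>') (Q' \<omega>')) \<le> C"
    proof (rule AE_I2)
      fix x assume "x \<in> space N"
      then have "\<bar>h x\<bar> \<le> C" by (rule that)
      then show "norm (h x * k e (f x) (Q' x)) \<le> C" by (auto simp: k_def)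
    qed
  qed
  have main: "\<bar>a - b\<bar> \<le> \<delta>" if \<delta>: "\<delta> > 0" for \<delta>
  proof -
    obtain e where e: "e > 0" and ue: "\<And>\<omega> y y'. \<omega> \<in> space M \<Longrightarrow> y \<in> K \<Longrightarrow> y' \<in> K \<Longrightarrow> dist y y' < e
        \<Longrightarrow> \<bar>g \<omega> y - g \<omega> y'\<bar> \<le> \<delta>"
      using ucont[OF \<delta>] by blast
    define c where "c = (\<integral>\<omega>'. k e z0 (Q' \<omega>') \<partial>N)"
    have c: "(\<integral>\<omega>'. k e z (Q' \<omega>') \<partial>N) = c" if "z \<in> S" for z
      using invN[OF that z0] by (simp add: c_def)
    \<comment> \<open>Finitely many \<open>e\<close>-balls centred in \<open>S\<close> cover almost
      every value of \<open>Q'\<close>, and all of them have the same mass \<open>c\<close>, so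
      \<open>card F * c\<close> is at least 1.\<close>
    have cpos: "c > 0"
    proof -
      obtain F where F: "F \<subseteq> S" "finite F" "S \<subseteq> (\<Union>z\<in>F. ball z e)"
        using seq_compact_imp_totally_bounded[OF compact_imp_seq_compact[OF S(1)]] e by blast
      have ik: "integrable N (\<lambda>\<omega>'. k e z (Q' \<omega>'))" for z
        using intN[of "\<lambda>_. 1" "\<lambda>_. z" 1 e] by simp
      have "(\<integral>\<omega>'. 1 \<partial>N) \<le> (\<integral>\<omega>'. (\<Sum>z\<in>F. k e z (Q' \<omega>')) \<partial>N)"
      proof (rule integral_mono_AE)
        show "AE \<omega>' in N. (1::real) \<le> (\<Sum>z\<in>F. k e z (Q' \<omega>'))"
          using QS'
        proof eventually_elim
          fix \<omega> assume "Q' \<omega> \<in> S"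
          then obtain z where z: "z \<in> F" "dist z (Q' \<omega>) < e" using F by auto
          then have "1 = k e z (Q' \<omega>)" by (simp add: k_def)
          also have "\<dots> \<le> (\<Sum>z\<in>F. k e z (Q' \<omega>))"
            by (rule member_le_sum) (use z F k01 in auto)
          finally show "1 \<le> (\<Sum>z\<in>F. k e z (Q' \<omega>))" .
        qed
      qed (use ik in auto)
      also have "\<dots> = card F * c"
        using ik c F by (subst Bochner_Integration.integral_sum) (auto simp: subset_iff)
      finally have "1 \<le> card F * c" by (simp add: N.prob_space)
      then show ?thesis by (metis le_less_trans mult_nonneg_nonpos not_less of_nat_0_le_iff zero_less_one)
    qed
    have L1: "(\<integral>\<omega>. (\<integral>\<omega>'. g \<omega> (Q \<omega>) * k e (Q \<omega>) (Q' \<omega>') \<partial>N) \<partial>M) = a * c"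
    proof -
      have "(\<integral>\<omega>. (\<integral>\<omega>'. g \<omega> (Q \<omega>) * k e (Q \<omega>) (Q' \<omega>') \<partial>N) \<partial>M) = (\<integral>\<omega>. g \<omega> (Q \<omega>) * c \<partial>M)"
        by (rule integral_cong_AE) (use QS in \<open>auto simp: c\<close>)
      then show ?thesis by (simp add: a_def)
    qed
    have L2: "(\<integral>\<omega>. (\<integral>\<omega>'. g \<omega> (Q' \<omega>') * k e (Q \<omega>) (Q' \<omega>') \<partial>N) \<partial>M) = b * c"
    proof -
      \<comment> \<open>By \<open>invM\<close> the centre \<open>y\<close> of the kernel may be
        replaced by \<open>Q' \<omega>'\<close>. Averaging over \<open>\<omega>'\<close> and
        exchanging the integrals then produces the mass \<open>c\<close>, while \<open>y\<close>
        inside \<open>g\<close> stays fixed.\<close>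
      have *: "(\<integral>\<omega>. g \<omega> y * k e (Q \<omega>) y \<partial>M) = (\<integral>\<omega>. g \<omega> y \<partial>M) * c" if y: "y \<in> S" for y
      proof -
        have "(\<integral>\<omega>. g \<omega> y * k e (Q \<omega>) y \<partial>M) = (\<integral>\<omega>'. (\<integral>\<omega>. g \<omega> y * k e (Q \<omega>) y \<partial>M) \<partial>N)"
          by (simp add: N.prob_space)
        also have "\<dots> = (\<integral>\<omega>'. (\<integral>\<omega>. g \<omega> y * k e (Q \<omega>) (Q' \<omega>') \<partial>M) \<partial>N)"
          by (rule integral_cong_AE) (use QS' in \<open>auto intro: invM y\<close>)
        also have "\<dots> = (\<integral>\<omega>. (\<integral>\<omega>'. g \<omega> y * k e (Q \<omega>) (Q' \<omega>') \<partial>N) \<partial>M)"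
          by (rule Fubini_bounded[OF M N, symmetric, of _ B]) (use gk y S in auto)
        also have "\<dots> = (\<integral>\<omega>. g \<omega> y * c \<partial>M)"
          by (rule integral_cong_AE) (use QS in \<open>auto simp: c\<close>)
        finally show ?thesis by simp
      qed
      have "(\<integral>\<omega>. (\<integral>\<omega>'. g \<omega> (Q' \<omega>') * k e (Q \<omega>) (Q' \<omega>') \<partial>N) \<partial>M)
          = (\<integral>\<omega>'. (\<integral>\<omega>. g \<omega> (Q' \<omega>') * k e (Q \<omega>) (Q' \<omega>') \<partial>M) \<partial>N)"
        by (rule Fubini_bounded[OF M N, of _ B]) (use gk K in auto)
      also have "\<dots> = (\<integral>\<omega>'. (\<integral>\<omega>. g \<omega> (Q' \<omega>') \<partial>M) * c \<partial>N)"
        by (rule integral_cong_AE) (use QS' in \<open>auto simp: *\<close>)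
      finally show ?thesis by (simp add: ba)
    qed
    have intMN: "integrable M (\<lambda>\<omega>. (\<integral>\<omega>'. g \<omega> (r \<omega> \<omega>') * k e (Q \<omega>) (Q' \<omega>') \<partial>N))"
      if [measurable]: "(\<lambda>(\<omega>, \<omega>'). g \<omega> (r \<omega> \<omega>')) \<in> borel_measurable (M \<Otimes>\<^sub>M N)"
        and r: "\<And>\<omega> \<omega>'. \<omega> \<in> space M \<Longrightarrow> \<omega>' \<in> space N \<Longrightarrow> r \<omega> \<omega>' \<in> K" for r
    proof (rule M.integrable_const_bound[of _ B])
      show "AE \<omega> in M. norm (\<integral>\<omega>'. g \<omega> (r \<omega> \<omega>') * k e (Q \<omega>) (Q' \<omega>') \<partial>N) \<le> B"
      proof (rule AE_I2)
        fix \<omega> assume \<omega>: "\<omega> \<in> space M"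
        show "norm (\<integral>\<omega>'. g \<omega> (r \<omega> \<omega>') * k e (Q \<omega>) (Q' \<omega>') \<partial>N) \<le> B"
          using \<omega> gk[OF \<omega> r[OF \<omega>]] B0
          by (intro order_trans[OF integral_norm_bound] N.integral_le_const N.integrable_const_bound[of _ B]) auto
      qed
    qed measurable
    have "\<bar>a * c - b * c\<bar> = \<bar>\<integral>\<omega>. (\<integral>\<omega>'. g \<omega> (Q \<omega>) * k e (Q \<omega>) (Q' \<omega>') \<partial>N)
        - (\<integral>\<omega>'. g \<omega> (Q' \<omega>') * k e (Q \<omega>) (Q' \<omega>') \<partial>N) \<partial>M\<bar>"
      unfolding L1[symmetric] L2[symmetric]
      by (subst Bochner_Integration.integral_diff[OF intMN intMN]) (use K in auto)
    also have "\<dots> \<le> (\<integral>\<omega>. \<bar>(\<integral>\<omega>'. g \<omega> (Q \<omega>) * k e (Q \<omega>) (Q' \<omega>') \<partial>N)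
        - (\<integral>\<omega>'. g \<omega> (Q' \<omega>') * k e (Q \<omega>) (Q' \<omega>') \<partial>N)\<bar> \<partial>M)"
      by (rule integral_abs_bound)
    also have "\<dots> \<le> (\<integral>\<omega>. \<delta> * c \<partial>M)"
    proof (rule integral_mono_AE)
      show "integrable M (\<lambda>\<omega>. \<bar>(\<integral>\<omega>'. g \<omega> (Q \<omega>) * k e (Q \<omega>) (Q' \<omega>') \<partial>N)
        - (\<integral>\<omega>'. g \<omega> (Q' \<omega>') * k e (Q \<omega>) (Q' \<omega>') \<partial>N)\<bar>)"
        by (intro integrable_abs Bochner_Integration.integrable_diff intMN) (use K in auto)
      show "AE \<omega> in M. \<bar>(\<integral>\<omega>'. g \<omega> (Q \<omega>) * k e (Q \<omega>) (Q' \<omega>') \<partial>N)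
        - (\<integral>\<omega>'. g \<omega> (Q' \<omega>') * k e (Q \<omega>) (Q' \<omega>') \<partial>N)\<bar> \<le> \<delta> * c"
        using QS AE_space
      proof eventually_elim
        fix \<omega> assume \<omega>: "Q \<omega> \<in> S" "\<omega> \<in> space M"
        have i1: "integrable N (\<lambda>\<omega>'. g \<omega> (Q \<omega>) * k e (Q \<omega>) (Q' \<omega>'))"
          by (rule intN[of _ _ B]) (use bounded K \<omega> in auto)
        have i2: "integrable N (\<lambda>\<omega>'. g \<omega> (Q' \<omega>') * k e (Q \<omega>) (Q' \<omega>'))"
          by (rule intN[of _ _ B]) (use bounded K \<omega> in auto)
        have i3: "integrable N (\<lambda>\<omega>'. \<delta> * k e (Q \<omega>) (Q' \<omega>'))"
          by (rule intN[of _ _ "\<bar>\<delta>\<bar>"]) auto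
        have "\<bar>(\<integral>\<omega>'. g \<omega> (Q \<omega>) * k e (Q \<omega>) (Q' \<omega>') \<partial>N)
          - (\<integral>\<omega>'. g \<omega> (Q' \<omega>') * k e (Q \<omega>) (Q' \<omega>') \<partial>N)\<bar>
          = \<bar>\<integral>\<omega>'. g \<omega> (Q \<omega>) * k e (Q \<omega>) (Q' \<omega>') - g \<omega> (Q' \<omega>') * k e (Q \<omega>) (Q' \<omega>') \<partial>N\<bar>"
          using i1 i2 by simp
        also have "\<dots> \<le> (\<integral>\<omega>'. \<bar>g \<omega> (Q \<omega>) * k e (Q \<omega>) (Q' \<omega>') - g \<omega> (Q' \<omega>') * k e (Q \<omega>) (Q' \<omega>')\<bar> \<partial>N)"
          by (rule integral_abs_bound)
        \<comment> \<open>Where the kernel does not vanish, \<open>Q \<omega>\<close> and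
          \<open>Q' \<omega>'\<close> are closer than \<open>e\<close>, so uniform continuity of
          \<open>g \<omega>\<close> applies.\<close>
        also have "\<dots> \<le> (\<integral>\<omega>'. \<delta> * k e (Q \<omega>) (Q' \<omega>') \<partial>N)"
          by (intro integral_mono integrable_abs Bochner_Integration.integrable_diff i1 i2 i3)
             (use ue[OF \<omega>(2)] K \<omega> in \<open>auto simp: k_def\<close>)
        also have "\<dots> = \<delta> * c" using c[OF \<omega>(1)] by simp
        finally show "\<bar>(\<integral>\<omega>'. g \<omega> (Q \<omega>) * k e (Q \<omega>) (Q' \<omega>') \<partial>N)
          - (\<integral>\<omega>'. g \<omega> (Q' \<omega>') * k e (Q \<omega>) (Q' \<omega>') \<partial>N)\<bar> \<le> \<delta> * c" .
      qed
    qed simp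
    also have "\<dots> = \<delta> * c" by (simp add: M.prob_space)
    finally have "\<bar>a - b\<bar> * c \<le> \<delta> * c" using cpos by (simp add: abs_mult flip: left_diff_distrib)
    then show ?thesis using cpos by simp
  qed
  have "\<bar>a - b\<bar> \<le> 0" by (rule field_le_epsilon) (use main in auto)
  then show ?thesis by (simp add: a_def b_def)
qed

section \<open>Orthonormal pairs\<close>

text \<open>For unit vectors with \<open>v\<close> equal to \<open>x\<close> or \<open>- x\<close>
  the value is 0, because \<open>sgn 0 = 0\<close>. The pair \<open>frame (x, v)\<close> then lies
  outside \<open>frames\<close>, which is a null event in dimension at least 2.\<close>

definition perp_dir :: "'a::euclidean_space \<Rightarrow> 'a \<Rightarrow> 'a" where
  "perp_dir x v = sgn (v - (x \<bullet> v) *\<^sub>R x)"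

definition frame :: "'a::euclidean_space \<times> 'a \<Rightarrow> 'a \<times> 'a" where
  "frame p = (fst p, perp_dir (fst p) (snd p))"

definition frames :: "('a::euclidean_space \<times> 'a) set" where
  "frames = {p. norm (fst p) = 1 \<and> norm (snd p) = 1 \<and> fst p \<bullet> snd p = 0}"

text \<open>For a pair in \<open>frames\<close>, these are the position and the velocity at time
  \<open>\<alpha>\<close> on the unit speed great circle that starts at \<open>fst p\<close> with
  velocity \<open>snd p\<close>.\<close>

definition rot :: "real \<Rightarrow> 'a::euclidean_space \<times> 'a \<Rightarrow> 'a \<times> 'a" where
  "rot \<alpha> p = (cos \<alpha> *\<^sub>R fst p + sin \<alpha> *\<^sub>R snd p, cos \<alpha> *\<^sub>R snd p - sin \<alpha> *\<^sub>R fst p)"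

text \<open>The clamping only serves to make the function continuous on the whole space.\<close>

definition angle_between :: "'a::euclidean_space \<Rightarrow> 'a \<Rightarrow> real" where
  "angle_between x v = arccos (max (-1) (min 1 (x \<bullet> v)))"

abbreviation sphere2 :: "('a::euclidean_space \<times> 'a) measure" where
  "sphere2 \<equiv> sphere_uniform \<Otimes>\<^sub>M sphere_uniform"

lemma space_sphere2: "space sphere2 = sphere 0 1 \<times> sphere (0::'a::euclidean_space) 1"
  by (simp add: space_pair_measure)

lemma prob_space_sphere2: "prob_space (sphere2 :: ('a::euclidean_space \<times> 'a) measure)"
  by unfold_locales

lemma abs_inner_sphere_le1:
  assumes "norm x = 1" "norm v = 1" shows "\<bar>x \<bullet> v\<bar> \<le> 1"
  using Cauchy_Schwarz_ineq2[of x v] assms by simp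

lemma angle_between_bounds: "0 \<le> angle_between x v" "angle_between x v \<le> pi"
  unfolding angle_between_def by (intro arccos_lbound arccos_ubound; linarith)+

lemma cos_angle_between:
  assumes "norm x = 1" "norm v = 1" shows "cos (angle_between x v) = x \<bullet> v"
  using abs_inner_sphere_le1[OF assms] by (simp add: angle_between_def)

lemma continuous_angle_between: "continuous_on UNIV (\<lambda>p. angle_between (fst p) (snd p))"
  unfolding angle_between_def
  by (intro continuous_on_arccos continuous_intros) auto

lemma measurable_perp_dir [measurable (raw)]:
  assumes "f \<in> borel_measurable M" "g \<in> borel_measurable M"
  shows "(\<lambda>x. perp_dir (f x) (g x)) \<in> borel_measurable M"
  using assms unfolding perp_dir_def by measurable

lemma measurable_angle_between [measurable (raw)]:
  assumes "f \<in> borel_measurable M" "g \<in> borel_measurable M"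
  shows "(\<lambda>x. angle_between (f x) (g x)) \<in> borel_measurable M"
  using measurable_compose[OF borel_measurable_Pair[OF assms] borel_measurable_continuous_onI[OF continuous_angle_between]]
  by simp

lemma measurable_frame [measurable (raw)]:
  assumes "f \<in> borel_measurable M"
  shows "(\<lambda>x. frame (f x)) \<in> borel_measurable M"
proof -
  have [measurable]: "(\<lambda>x. fst (f x)) \<in> borel_measurable M" "(\<lambda>x. snd (f x)) \<in> borel_measurable M"
    by (rule measurable_compose[OF assms], intro borel_measurable_continuous_onI continuous_intros)+
  show ?thesis unfolding frame_def by (rule borel_measurable_Pair) measurable
qed

lemma measurable_sphere2_borel [measurable]: "(\<lambda>p. p) \<in> borel_measurable sphere2"
proof -
  have "(\<lambda>p. (fst p, snd p)) \<in> borel_measurable sphere2"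
    by (rule borel_measurable_Pair) measurable
  then show ?thesis by simp
qed

lemma measurable_frame_sphere2 [measurable]: "frame \<in> borel_measurable sphere2"
  using measurable_frame[OF measurable_sphere2_borel] by simp

lemma continuous_rot: "continuous_on S (rot \<alpha>)"
  unfolding rot_def by (intro continuous_intros)

lemma measurable_rot [measurable (raw)]:
  assumes "f \<in> borel_measurable M"
  shows "(\<lambda>x. rot \<alpha> (f x)) \<in> borel_measurable M"
  by (rule measurable_compose[OF assms borel_measurable_continuous_onI[OF continuous_rot]])

lemma norm_perp_dir_le: "norm (perp_dir x v) \<le> 1"
  by (simp add: perp_dir_def norm_sgn)

lemma inner_perp_dir: "norm x = 1 \<Longrightarrow> x \<bullet> perp_dir x v = 0"
  by (simp add: perp_dir_def sgn_div_norm inner_diff_right dot_square_norm)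

lemma compact_frames: "compact (frames :: ('a::euclidean_space \<times> 'a) set)"
proof (rule compact_eq_bounded_closed[THEN iffD2], intro conjI)
  have "(frames :: ('a \<times> 'a) set) \<subseteq> sphere 0 1 \<times> sphere 0 1" by (auto simp: frames_def)
  then show "bounded (frames :: ('a \<times> 'a) set)"
    by (rule bounded_subset[rotated]) (intro bounded_Times bounded_sphere)
  show "closed (frames :: ('a \<times> 'a) set)"
    unfolding frames_def by (intro closed_Collect_conj closed_Collect_eq continuous_intros)
qed

lemma AE_perp_dir_unit:
  fixes x :: "'a::euclidean_space"
  assumes "DIM('a) \<ge> 2"
  shows "AE v in sphere_uniform. norm (perp_dir x v) = 1"
proof -
  have "dim (span {x}) \<le> 1" by (simp add: dim_insert)
  then have "AE v in sphere_uniform. v \<notin> span {x}"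
    using assms by (intro sphere_uniform_lowdim_null) auto
  then show ?thesis
  proof eventually_elim
    fix v assume "v \<notin> span {x}"
    then have "v - (x \<bullet> v) *\<^sub>R x \<noteq> 0" by (auto simp: span_singleton)
    then show "norm (perp_dir x v) = 1" by (simp add: perp_dir_def norm_sgn)
  qed
qed

lemma AE_frame:
  assumes "DIM('a::euclidean_space) \<ge> 2"
  shows "AE p in sphere2. frame p \<in> (frames :: ('a \<times> 'a) set)"
proof (rule sphere_pair.AE_pair_measure)
  have "frames \<in> sets (borel :: ('a \<times> 'a) measure)"
    by (intro borel_closed compact_imp_closed compact_frames)
  then show "{p \<in> space sphere2. frame p \<in> (frames :: ('a \<times> 'a) set)} \<in> sets sphere2"
    by measurable
  show "AE x in sphere_uniform. AE v in sphere_uniform. frame (x, v) \<in> (frames :: ('a \<times> 'a) set)"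
  proof (rule AE_I2)
    fix x :: 'a assume "x \<in> space sphere_uniform"
    then have x: "norm x = 1" by simp
    show "AE v in sphere_uniform. frame (x, v) \<in> frames"
      using AE_perp_dir_unit[OF assms, of x]
      by eventually_elim (simp add: frames_def frame_def x inner_perp_dir)
  qed
qed

lemma rot_frames: "p \<in> frames \<Longrightarrow> rot \<alpha> p \<in> frames"
proof -
  assume p: "p \<in> frames"
  obtain x y where xy: "p = (x, y)" by (cases p)
  have *: "x \<bullet> x = 1" "y \<bullet> y = 1" "x \<bullet> y = 0" "y \<bullet> x = 0"
    using p by (auto simp: frames_def xy inner_commute dot_square_norm)
  have "cos \<alpha> * cos \<alpha> + sin \<alpha> * sin \<alpha> = 1"
    using sin_cos_squared_add[of \<alpha>] by (simp add: power2_eq_square)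
  then show ?thesis
    by (simp add: frames_def rot_def xy norm_eq_1 inner_add inner_diff * algebra_simps)
qed

lemma rot_rot: "rot \<alpha> (rot \<beta> p) = rot (\<alpha> + \<beta>) p"
  by (simp add: rot_def cos_add sin_add algebra_simps)

text \<open>The tangential part of \<open>v\<close> has length
  \<open>sin (angle_between x v)\<close>. If \<open>v\<close> is \<open>x\<close> or
  \<open>- x\<close>, the tangent is 0 but so is the sine, so there are no exceptional
  pairs.\<close>

lemma frame_decomposition:
  fixes x v :: "'a::euclidean_space"
  assumes "norm x = 1" "norm v = 1"
  shows "v = fst (rot (angle_between x v) (frame (x, v)))"
proof -
  have "norm (v - (x \<bullet> v) *\<^sub>R x) ^ 2 = 1 - (x \<bullet> v)\<^sup>2"
  proof -
    have *: "x \<bullet> x = 1" "v \<bullet> v = 1" using assms by (simp_all add: norm_eq_1)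
    show ?thesis
      unfolding power2_norm_eq_inner
      by (simp add: inner_diff_left inner_diff_right inner_commute[of v x] power2_eq_square *)
  qed
  then have "norm (v - (x \<bullet> v) *\<^sub>R x) = sqrt (1 - (x \<bullet> v)\<^sup>2)"
    by (metis norm_ge_zero real_sqrt_unique)
  also have "\<dots> = sin (angle_between x v)"
    using abs_inner_sphere_le1[OF assms] by (simp add: angle_between_def sin_arccos)
  finally have s: "sin (angle_between x v) = norm (v - (x \<bullet> v) *\<^sub>R x)" by simp
  have "norm w *\<^sub>R sgn w = w" for w :: 'a by (cases "w = 0") (auto simp: sgn_div_norm)
  then show ?thesis
    by (simp add: rot_def frame_def perp_dir_def s cos_angle_between[OF assms])
qed

text \<open>The witness is the reflection in the hyperplane orthogonal to \<open>a - b\<close>. It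
  fixes that hyperplane, which lets a later reflection leave an already adjusted vector in
  place.\<close>

lemma exists_reflection:
  fixes a b :: "'a::euclidean_space"
  assumes "norm a = norm b"
  obtains T where "orthogonal_transformation T" "T a = b" "\<And>x. x \<bullet> a = x \<bullet> b \<Longrightarrow> T x = x"
proof (cases "a = b")
  case True
  then show ?thesis using that[of "\<lambda>x. x"] by simp
next
  case False
  define w where "w = a - b"
  define T where "T x = x - (2 * (w \<bullet> x) / (w \<bullet> w)) *\<^sub>R w" for x
  have w: "w \<bullet> w \<noteq> 0" using False by (simp add: w_def)
  have aa: "a \<bullet> a = b \<bullet> b" using assms by (simp add: norm_eq)
  have "linear T"
    by (rule linearI)
       (simp_all add: T_def inner_add_right distrib_left add_divide_distrib scaleR_add_left scaleR_diff_right)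
  moreover have "T x \<bullet> T y = x \<bullet> y" for x y
    using w by (simp add: T_def inner_diff inner_commute field_simps)
  ultimately have "orthogonal_transformation T" by (simp add: orthogonal_transformation_def)
  moreover have "T a = b"
  proof -
    have "w \<bullet> w = 2 * (w \<bullet> a)"
      using aa by (simp add: w_def inner_diff inner_commute)
    then show ?thesis using w by (simp add: T_def) (simp add: w_def)
  qed
  moreover have "T x = x" if "x \<bullet> a = x \<bullet> b" for x
    using that by (simp add: T_def w_def inner_diff inner_commute)
  ultimately show ?thesis using that by blast
qed

text \<open>One reflection carries \<open>fst p\<close> to \<open>fst q\<close>. A second one
  adjusts the other vector along \<open>T1 (snd p) - snd q\<close>, which is orthogonal to
  \<open>fst q\<close>, and so it does not move \<open>fst q\<close>.\<close>

lemma frames_transitive: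
  fixes p q :: "'a::euclidean_space \<times> 'a"
  assumes "p \<in> frames" "q \<in> frames"
  obtains T where "orthogonal_transformation T" "q = (T (fst p), T (snd p))"
proof -
  obtain T1 where T1: "orthogonal_transformation T1" "T1 (fst p) = fst q"
    using exists_reflection[of "fst p" "fst q"] assms by (auto simp: frames_def)
  have n1: "norm (T1 (snd p)) = norm (snd q)"
    using assms T1 by (simp add: frames_def orthogonal_transformation_norm)
  have "fst q \<bullet> T1 (snd p) = fst p \<bullet> snd p"
    using T1 by (metis orthogonal_transformation_def)
  then have "fst q \<bullet> T1 (snd p) = fst q \<bullet> snd q"
    using assms by (simp add: frames_def)
  then obtain T2 where "orthogonal_transformation T2" "T2 (T1 (snd p)) = snd q" "T2 (fst q) = fst q"
    using exists_reflection[OF n1] by metis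
  then show ?thesis
    using that[of "T2 \<circ> T1"] T1 by (simp add: orthogonal_transformation_compose prod_eq_iff)
qed

lemma perp_dir_orthogonal:
  assumes T: "orthogonal_transformation T"
  shows "perp_dir (T x) (T v) = T (perp_dir x v)"
proof -
  have lin: "linear T" and inn: "T v \<bullet> T w = v \<bullet> w" for v w
    using T by (auto simp: orthogonal_transformation_def)
  have "T v - (T x \<bullet> T v) *\<^sub>R T x = T (v - (x \<bullet> v) *\<^sub>R x)"
    by (simp add: linear_diff[OF lin] linear_cmul[OF lin] inn)
  then show ?thesis
    by (simp add: perp_dir_def sgn_div_norm orthogonal_transformation_norm[OF T] linear_cmul[OF lin])
qed

lemma frame_orthogonal:
  assumes "orthogonal_transformation T"
  shows "frame (T x, T v) = (T (fst (frame (x, v))), T (snd (frame (x, v))))"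
  by (simp add: frame_def perp_dir_orthogonal[OF assms])

lemma rot_orthogonal:
  assumes "orthogonal_transformation T"
  shows "rot \<alpha> (T x, T y) = (T (fst (rot \<alpha> (x, y))), T (snd (rot \<alpha> (x, y))))"
proof -
  have "linear T" using assms orthogonal_transformation_linear by blast
  then show ?thesis by (simp add: rot_def linear_add linear_cmul linear_diff)
qed

lemma dist_orthogonal_pair:
  assumes "orthogonal_transformation T"
  shows "dist (T x, T y) (T x', T y') = dist (x, y) (x', y')"
proof -
  have "linear T" using assms orthogonal_transformation_linear by blast
  then have "dist (T x) (T x') = dist x x'" for x x'
    by (simp add: dist_norm orthogonal_transformation_norm[OF assms] flip: linear_diff)
  then show ?thesis by (simp add: dist_Pair_Pair)
qed

lemma angle_between_orthogonal:
  assumes "orthogonal_transformation T"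
  shows "angle_between (T x) (T v) = angle_between x v"
  using assms by (simp add: angle_between_def orthogonal_transformation_def)

text \<open>For \<open>\<alpha> = 0\<close> this is the independence of angle and frame, and for \<open>H\<close> not depending on the
  angle it is the invariance of the law of the frame under rotations in its plane.\<close>

lemma integral_angle_frame:
  fixes H :: "real \<Rightarrow> 'a::euclidean_space \<times> 'a \<Rightarrow> real"
  assumes dim: "DIM('a) \<ge> 2" and H: "continuous_on UNIV (\<lambda>(t, p). H t p)"
  shows "(\<integral>p. H (angle_between (fst p) (snd p)) (frame p) \<partial>sphere2)
       = (\<integral>p. (\<integral>q. H (angle_between (fst p) (snd p)) (rot \<alpha> (frame q)) \<partial>sphere2) \<partial>(sphere2 :: ('a \<times> 'a) measure))"
proof -
  \<comment> \<open>Radius 2 accommodates degenerate pairs as well: if the tangent is 0 or a unit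
    vector, both components of the rotated pair have norm at most 2, so \<open>K\<close> contains
    all values and not only almost all.\<close>
  define K :: "('a \<times> 'a) set" where "K = cball 0 2 \<times> cball 0 2"
  have mH: "(\<lambda>x. H (f x) (h x)) \<in> borel_measurable M"
    if "f \<in> borel_measurable M" "h \<in> borel_measurable M" for f :: "'z \<Rightarrow> real" and h M
    using measurable_compose[OF borel_measurable_Pair[OF that] borel_measurable_continuous_onI[OF H]] by simp
  have cK: "compact ({0..pi} \<times> K)" unfolding K_def by (intro compact_Times compact_cball compact_Icc)
  have cH: "continuous_on ({0..pi} \<times> K) (\<lambda>(t, p). H t p)"
    using H continuous_on_subset by blast
  have "bounded ((\<lambda>(t, p). H t p) ` ({0..pi} \<times> K))"
    using compact_imp_bounded[OF compact_continuous_image[OF cH cK]] .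
  then obtain B where B: "\<And>t p. t \<in> {0..pi} \<Longrightarrow> p \<in> K \<Longrightarrow> \<bar>H t p\<bar> \<le> B"
    unfolding bounded_iff by force
  have uc: "uniformly_continuous_on ({0..pi} \<times> K) (\<lambda>(t, p). H t p)"
    using compact_uniformly_continuous[OF cH cK] .
  have nf: "rot \<beta> (frame p) \<in> K" if "p \<in> space sphere2" for p \<beta>
  proof -
    obtain x v where p: "p = (x, v)" by (cases p)
    have "norm x = 1" using that by (auto simp: space_sphere2 p)
    have b: "norm (cos \<beta> *\<^sub>R x) \<le> 1" "norm (sin \<beta> *\<^sub>R x) \<le> 1"
        "norm (cos \<beta> *\<^sub>R perp_dir x v) \<le> 1" "norm (sin \<beta> *\<^sub>R perp_dir x v) \<le> 1"
      using \<open>norm x = 1\<close> mult_mono[OF abs_cos_le_one[of \<beta>] norm_perp_dir_le[of x v]]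
         mult_mono[OF abs_sin_le_one[of \<beta>] norm_perp_dir_le[of x v]] by auto
    show "rot \<beta> (frame p) \<in> K"
      using norm_triangle_ineq[of "cos \<beta> *\<^sub>R x" "sin \<beta> *\<^sub>R perp_dir x v"]
        norm_triangle_ineq4[of "cos \<beta> *\<^sub>R perp_dir x v" "sin \<beta> *\<^sub>R x"] b
      by (simp add: K_def rot_def frame_def p)
  qed
  have rot0: "rot 0 p = p" for p :: "'a \<times> 'a" by (simp add: rot_def)
  have mrot: "(\<lambda>q. rot \<alpha> (frame q)) \<in> borel_measurable (sphere2 :: ('a \<times> 'a) measure)"
    by measurable
  show ?thesis
  proof (rule integral_transitive_average[where K = K and S = frames and B = B
        and M = "sphere2 :: ('a \<times> 'a) measure" and N = "sphere2 :: ('a \<times> 'a) measure"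
        and Q = frame and Q' = "\<lambda>q. rot \<alpha> (frame q)" and g = "\<lambda>p. H (angle_between (fst p) (snd p))"])
    show "prob_space (sphere2 :: ('a \<times> 'a) measure)" "prob_space (sphere2 :: ('a \<times> 'a) measure)"
      by (rule prob_space_sphere2)+
    show "frame \<omega> \<in> K" if "\<omega> \<in> space sphere2" for \<omega> :: "'a \<times> 'a"
      using nf[OF that, of 0] by (simp add: rot0)
    show "rot \<alpha> (frame \<omega>) \<in> K" if "\<omega> \<in> space sphere2" for \<omega> :: "'a \<times> 'a"
      using nf[OF that] by simp
    show "frames \<subseteq> K" by (auto simp: frames_def K_def)
    show "AE \<omega> in sphere2. frame \<omega> \<in> (frames :: ('a \<times> 'a) set)" by (rule AE_frame[OF dim])
    then show "AE \<omega> in sphere2. rot \<alpha> (frame \<omega>) \<in> (frames :: ('a \<times> 'a) set)"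
      by eventually_elim (rule rot_frames)
    show "\<exists>e>0. \<forall>\<omega>\<in>space (sphere2 :: ('a \<times> 'a) measure). \<forall>y\<in>K. \<forall>y'\<in>K. dist y y' < e \<longrightarrow>
        \<bar>H (angle_between (fst \<omega>) (snd \<omega>)) y - H (angle_between (fst \<omega>) (snd \<omega>)) y'\<bar> \<le> \<delta>"
      if \<delta>: "\<delta> > 0" for \<delta>
    proof -
      obtain e where e: "e > 0" and ee: "\<And>z z'. z \<in> {0..pi} \<times> K \<Longrightarrow> z' \<in> {0..pi} \<times> K \<Longrightarrow> dist z' z < e \<Longrightarrow>
          dist ((\<lambda>(t, p). H t p) z') ((\<lambda>(t, p). H t p) z) < \<delta>"
        using uc \<delta> unfolding uniformly_continuous_on_def by meson
      have "\<bar>H t y - H t y'\<bar> \<le> \<delta>" if "t \<in> {0..pi}" "y \<in> K" "y' \<in> K" "dist y y' < e" for t y y'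
        using ee[of "(t, y')" "(t, y)"] that by (simp add: dist_Pair_Pair dist_real_def)
      then show ?thesis
        using e by (intro exI[of _ e] conjI ballI impI) (simp_all add: angle_between_bounds)
    qed
    \<comment> \<open>An orthogonal \<open>T\<close> with \<open>T z = z'\<close> commutes with
      \<open>frame\<close> and \<open>rot\<close> and preserves both the distance and the law of the
      pair of points.\<close>
    show "(\<integral>\<omega>'. (if dist z (rot \<alpha> (frame \<omega>')) < e then 1 else 0) \<partial>sphere2)
        = (\<integral>\<omega>'. (if dist z' (rot \<alpha> (frame \<omega>')) < e then 1 else 0 :: real) \<partial>sphere2)"
      if zz: "z \<in> frames" "z' \<in> frames" for e and z z' :: "'a \<times> 'a"
    proof -
      obtain T where T: "orthogonal_transformation T" "z' = (T (fst z), T (snd z))"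
        using frames_transitive[OF zz] by blast
      have *: "dist z' (rot \<alpha> (frame (T x, T v))) = dist z (rot \<alpha> (frame (x, v)))" for x v
        using dist_orthogonal_pair[OF T(1), of "fst z" "snd z"]
        by (simp add: T frame_orthogonal rot_orthogonal)
      define h :: "'a \<times> 'a \<Rightarrow> real" where "h = (\<lambda>\<omega>'. if dist z' (rot \<alpha> (frame \<omega>')) < e then 1 else 0)"
      have "h \<in> borel_measurable sphere2" unfolding h_def by measurable
      from integral_sphere_pair_orthogonal[OF T(1) this] show ?thesis
        by (simp only: h_def * prod.collapse)
    qed
    \<comment> \<open>The same transformation leaves the angle unchanged, and \<open>y\<close> is
      held fixed inside \<open>H\<close>, so only the centre of the kernel moves.\<close>
    show "(\<integral>\<omega>. H (angle_between (fst \<omega>) (snd \<omega>)) y * (if dist (frame \<omega>) z < e then 1 else 0) \<partial>sphere2)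
        = (\<integral>\<omega>. H (angle_between (fst \<omega>) (snd \<omega>)) y * (if dist (frame \<omega>) z' < e then 1 else 0) \<partial>sphere2)"
      if "y \<in> frames" and zz: "z \<in> frames" "z' \<in> frames" for e and y z z' :: "'a \<times> 'a"
    proof -
      obtain T where T: "orthogonal_transformation T" "z' = (T (fst z), T (snd z))"
        using frames_transitive[OF zz] by blast
      have *: "dist (frame (T x, T v)) z' = dist (frame (x, v)) z" for x v
        using dist_orthogonal_pair[OF T(1), of _ _ "fst z" "snd z"]
        by (simp add: T frame_orthogonal)
      have [measurable]: "(\<lambda>\<omega>. H (angle_between (fst \<omega>) (snd \<omega>)) y) \<in> borel_measurable sphere2"
        by (rule mH) measurable
      define h :: "'a \<times> 'a \<Rightarrow> real" where "h = (\<lambda>\<omega>. H (angle_between (fst \<omega>) (snd \<omega>)) y * (if dist (frame \<omega>) z' < e then 1 else 0))"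
      have "h \<in> borel_measurable sphere2" unfolding h_def by measurable
      from integral_sphere_pair_orthogonal[OF T(1) this] show ?thesis
        by (simp only: h_def * prod.collapse fst_conv snd_conv angle_between_orthogonal[OF T(1)])
    qed
    show "\<bar>H (angle_between (fst \<omega>) (snd \<omega>)) y\<bar> \<le> B" if "y \<in> K" for \<omega> y
      by (rule B[OF _ that]) (simp add: angle_between_bounds)
    show "(\<lambda>(\<omega>, \<omega>'). H (angle_between (fst \<omega>) (snd \<omega>)) (rot \<alpha> (frame \<omega>')))
        \<in> borel_measurable (sphere2 \<Otimes>\<^sub>M sphere2)"
      unfolding case_prod_beta by (rule mH) measurable
    show "(\<lambda>\<omega>. H (angle_between (fst \<omega>) (snd \<omega>)) (frame \<omega>)) \<in> borel_measurable sphere2"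
      by (rule mH) measurable
    show "(\<lambda>\<omega>. H (angle_between (fst \<omega>) (snd \<omega>)) y) \<in> borel_measurable sphere2" for y
      by (rule mH) measurable
  qed (rule mrot measurable_frame_sphere2 compact_frames)+
qed

section \<open>Moments of a coordinate of the second vector\<close>

text \<open>Bernoulli's inequality gives (1 + 1/m)^m >= 2. This is the induction step that bounds
  the product of the first m odd numbers by m^m.\<close>

lemma Suc_power_self_ge: "(2 * real m + 1) * real m ^ m \<le> real (Suc m) ^ Suc m"
proof (cases "m = 0")
  case False
  have "1 + real m * (1 / real m) \<le> (1 + 1 / real m) ^ m"
    by (rule Bernoulli_inequality, rule order_trans[of _ 0]) auto
  then have "2 * real m ^ m \<le> (1 + 1 / real m) ^ m * real m ^ m"
    using False by (intro mult_right_mono) auto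
  also have "\<dots> = real (Suc m) ^ m"
    using False by (simp add: power_mult_distrib[symmetric] field_simps)
  finally have "2 * real m ^ m * real (Suc m) \<le> real (Suc m) ^ m * real (Suc m)"
    by (intro mult_right_mono) auto
  moreover have "(2 * real m + 1) * real m ^ m \<le> 2 * real m ^ m * real (Suc m)"
    by (simp add: algebra_simps)
  ultimately show ?thesis by (simp only: power_Suc mult.commute)
qed simp

lemma coeff_one_plus_square_power:
  "coeff ([:1, 0, 1:] ^ m :: real poly) 0 = 1"
  "coeff ([:1, 0, 1:] ^ m :: real poly) (Suc 0) = 0"
  "coeff ([:1, 0, 1:] ^ m :: real poly) 2 = real m"
  by (induction m) (simp_all add: coeff_pCons numeral_2_eq_2)

text \<open>The tangent \<open>Y\<close> is uniform in the hyperplane orthogonal to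
  \<open>x\<close>, of dimension N = \<open>DIM('a) - 1\<close>. By invariance all its even moments
  are multiples of the moments J of one coordinate. Expressing mixed moments of two coordinates
  through J and summing over an orthonormal basis, where |Y| = 1, gives (N + 2m) J(m+1) = (2m+1)
  J(m), of which only J(m+1) <= (2m+1)/N J(m) is kept. A general \<open>u\<close> is first projected
  to the hyperplane, which shortens it.\<close>

lemma perp_coordinate_moment:
  fixes x u :: "'a::euclidean_space"
  assumes dim: "DIM('a) \<ge> 2" and x: "norm x = 1"
  shows "(\<integral>v. (u \<bullet> perp_dir x v) ^ (2 * m) \<partial>sphere_uniform) \<le> (real m / (real DIM('a) - 1)) ^ m * norm u ^ (2 * m)"
proof -
  define Y where "Y = perp_dir x"
  define W where "W = {y. x \<bullet> y = 0}"
  have W: "subspace W" by (simp add: W_def subspace_hyperplane)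
  obtain B where B: "B \<subseteq> W" "pairwise orthogonal B" "\<And>b. b \<in> B \<Longrightarrow> norm b = 1"
      "independent B" "card B = dim W" "span B = W"
    using orthonormal_basis_subspace[OF W] by metis
  have finB: "finite B" using B(4) by (rule independent_imp_finite)
  have "x \<noteq> 0" using x by auto
  then have cardB: "card B = DIM('a) - 1"
    by (simp add: B(5) W_def dim_hyperplane)
  define N where "N = real DIM('a) - 1"
  have N: "N = real (card B)" "N \<ge> 1" using dim by (auto simp: N_def cardB of_nat_diff)
  have "B \<noteq> {}" using N by auto
  then obtain e where e: "e \<in> B" by blast
  have eW: "e \<in> W" "norm e = 1" using e B by auto
  have xY: "x \<bullet> Y v = 0" for v unfolding Y_def by (rule inner_perp_dir[OF x])
  have [measurable]: "Y \<in> borel_measurable sphere_uniform" unfolding Y_def by measurable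
  have leY: "\<bar>w \<bullet> Y v\<bar> \<le> norm w" for w v
    using Cauchy_Schwarz_ineq2[of w "Y v"] mult_left_mono[OF norm_perp_dir_le[of x v] norm_ge_zero[of w]]
    by (simp add: Y_def)
  have int: "integrable sphere_uniform (\<lambda>v. (w \<bullet> Y v) ^ i * (w' \<bullet> Y v) ^ j)" for w w' :: 'a and i j
  proof (rule sphere_uniform.integrable_const_bound[of _ "norm w ^ i * norm w' ^ j"])
    show "AE v in sphere_uniform. norm ((w \<bullet> Y v) ^ i * (w' \<bullet> Y v) ^ j) \<le> norm w ^ i * norm w' ^ j"
      by (intro AE_I2) (auto simp: abs_mult power_abs intro!: mult_mono power_mono leY)
  qed measurable
  have int1: "integrable sphere_uniform (\<lambda>v. (w \<bullet> Y v) ^ i)" for w i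
    using int[of w i w 0] by simp
  \<comment> \<open>Both vectors are orthogonal to \<open>x\<close>, so the reflection carrying
    \<open>w\<close> to \<open>w'\<close> fixes \<open>x\<close> and commutes with
    \<open>Y\<close>.\<close>
  have inv: "(\<integral>v. (w \<bullet> Y v) ^ i \<partial>sphere_uniform) = (\<integral>v. (w' \<bullet> Y v) ^ i \<partial>sphere_uniform)"
    if ww: "w \<in> W" "w' \<in> W" "norm w = norm w'" for w w' i
  proof -
    obtain T where T: "orthogonal_transformation T" "T w = w'" "T x = x"
      using exists_reflection[OF ww(3)] ww by (metis (mono_tags, lifting) W_def mem_Collect_eq)
    have "(\<integral>v. (w' \<bullet> Y v) ^ i \<partial>sphere_uniform) = (\<integral>v. (w' \<bullet> Y (T v)) ^ i \<partial>sphere_uniform)"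
      by (rule integral_sphere_orthogonal[OF T(1), symmetric]) measurable
    also have "\<dots> = (\<integral>v. (w \<bullet> Y v) ^ i \<partial>sphere_uniform)"
    proof -
      have "Y (T v) = T (Y v)" for v
        unfolding Y_def using perp_dir_orthogonal[OF T(1), of x v] T(3) by simp
      then have "w' \<bullet> Y (T v) = w \<bullet> Y v" for v
        using T by (metis orthogonal_transformation_def)
      then show ?thesis by simp
    qed
    finally show ?thesis by simp
  qed
  define J where "J m = (\<integral>v. (e \<bullet> Y v) ^ (2 * m) \<partial>sphere_uniform)" for m
  have J_scale: "(\<integral>v. (w \<bullet> Y v) ^ (2 * m) \<partial>sphere_uniform) = norm w ^ (2 * m) * J m" if "w \<in> W" for w m
  proof -
    have "norm w *\<^sub>R e \<in> W" using eW W by (simp add: subspace_scale)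
    then have "(\<integral>v. (w \<bullet> Y v) ^ (2 * m) \<partial>sphere_uniform) = (\<integral>v. ((norm w *\<^sub>R e) \<bullet> Y v) ^ (2 * m) \<partial>sphere_uniform)"
      using that eW by (intro inv) auto
    then show ?thesis by (simp add: J_def power_mult_distrib)
  qed
  have cross: "(2 * real m - 1) * (\<integral>v. (b \<bullet> Y v) ^ 2 * (e \<bullet> Y v) ^ (2 * m - 2) \<partial>sphere_uniform) = J m"
    if b: "b \<in> B - {e}" and m: "m \<ge> 1" for b m
  proof -
    \<comment> \<open>\<open>c i\<close> is the coefficient of t^i in the moment of order 2m of the
      coordinate along t b + e. As \<open>b\<close> and \<open>e\<close> are orthonormal,
      \<open>J_scale\<close> identifies this polynomial with J(m) (1 + t^2)^m. At t^2 the binomial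
      coefficient m (2m - 1) meets m.\<close>
    define c where "c i = real (2 * m choose i) * (\<integral>v. (b \<bullet> Y v) ^ i * (e \<bullet> Y v) ^ (2 * m - i) \<partial>sphere_uniform)" for i
    define p where "p = (\<Sum>i\<le>2 * m. monom (c i) i)"
    define q where "q = smult (J m) ([:1, 0, 1:] ^ m)"
    have be: "b \<bullet> e = 0" "e \<bullet> b = 0" "norm b = 1" "b \<in> W"
      using b B e by (auto simp: pairwise_def orthogonal_def)
    have "poly p t = poly q t" for t
    proof -
      have "poly p t = (\<Sum>i\<le>2 * m. (\<integral>v. real (2 * m choose i) * (t * (b \<bullet> Y v)) ^ i * (e \<bullet> Y v) ^ (2 * m - i) \<partial>sphere_uniform))"
        by (simp add: p_def poly_sum poly_monom c_def power_mult_distrib ac_simps flip: integral_mult_right_zero)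
      also have "\<dots> = (\<integral>v. (\<Sum>i\<le>2 * m. real (2 * m choose i) * (t * (b \<bullet> Y v)) ^ i * (e \<bullet> Y v) ^ (2 * m - i)) \<partial>sphere_uniform)"
        by (rule Bochner_Integration.integral_sum[symmetric])
           (auto simp: power_mult_distrib mult.assoc intro!: int)
      also have "\<dots> = (\<integral>v. ((t *\<^sub>R b + e) \<bullet> Y v) ^ (2 * m) \<partial>sphere_uniform)"
        by (simp add: binomial_ring inner_add_left)
      also have "\<dots> = norm (t *\<^sub>R b + e) ^ (2 * m) * J m"
        using W be(4) eW by (intro J_scale subspace_add subspace_scale) auto
      also have "norm (t *\<^sub>R b + e) ^ (2 * m) = (1 + t\<^sup>2) ^ m"
      proof -
        have "norm (t *\<^sub>R b + e) ^ 2 = 1 + t\<^sup>2"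
          using be eW unfolding power2_norm_eq_inner by (simp add: inner_add norm_eq_1 power2_eq_square)
        then show ?thesis by (simp only: power_mult)
      qed
      finally show ?thesis by (simp add: q_def power2_eq_square)
    qed
    then have "p = q" by (simp add: poly_eq_poly_eq_iff[symmetric] fun_eq_iff)
    then have "coeff p 2 = coeff q 2" by simp
    moreover have "coeff p 2 = c 2"
      using m by (simp add: p_def coeff_sum)
    moreover have "coeff q 2 = J m * real m"
      by (simp add: q_def coeff_one_plus_square_power)
    moreover have "real (2 * m choose 2) = real m * (2 * real m - 1)"
      using m by (simp add: choose_two of_nat_diff)
    ultimately show ?thesis using m by (simp add: c_def)
  qed
  have parseval: "AE v in sphere_uniform. (\<Sum>b\<in>B - {e}. (b \<bullet> Y v)\<^sup>2) = 1 - (e \<bullet> Y v)\<^sup>2"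
    using AE_perp_dir_unit[OF dim, of x]
  proof eventually_elim
    fix v assume "norm (perp_dir x v) = 1"
    then have "Y v \<bullet> Y v = 1" by (simp add: Y_def norm_eq_1)
    have "Y v \<in> span B" using xY by (simp add: B(6) W_def)
    then have "Y v \<bullet> (\<Sum>b\<in>B. (Y v \<bullet> b) *\<^sub>R b) = 1"
      using orthonormal_basis_expand[OF B(2,3) _ finB] \<open>Y v \<bullet> Y v = 1\<close> by simp
    then have "(\<Sum>b\<in>B. (b \<bullet> Y v)\<^sup>2) = 1"
      by (simp add: inner_sum_right power2_eq_square inner_commute)
    then show "(\<Sum>b\<in>B - {e}. (b \<bullet> Y v)\<^sup>2) = 1 - (e \<bullet> Y v)\<^sup>2"
      using sum.remove[OF finB e, of "\<lambda>b. (b \<bullet> Y v)\<^sup>2"] by simp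
  qed
  have J0: "J m \<ge> 0" for m unfolding J_def by (intro integral_nonneg_AE AE_I2) simp
  have rec: "J (Suc m) \<le> (2 * real m + 1) / N * J m" for m
  proof -
    have "(\<Sum>b\<in>B - {e}. J (Suc m)) = (\<Sum>b\<in>B - {e}. (2 * real m + 1) * (\<integral>v. (b \<bullet> Y v) ^ 2 * (e \<bullet> Y v) ^ (2 * m) \<partial>sphere_uniform))"
      by (intro sum.cong refl) (use cross[of _ "Suc m"] in \<open>simp add: add.commute\<close>)
    also have "\<dots> = (2 * real m + 1) * (\<integral>v. (\<Sum>b\<in>B - {e}. (b \<bullet> Y v) ^ 2 * (e \<bullet> Y v) ^ (2 * m)) \<partial>sphere_uniform)"
      by (subst Bochner_Integration.integral_sum) (auto simp: sum_distrib_left intro!: int)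
    also have "(\<integral>v. (\<Sum>b\<in>B - {e}. (b \<bullet> Y v) ^ 2 * (e \<bullet> Y v) ^ (2 * m)) \<partial>sphere_uniform)
        = (\<integral>v. (e \<bullet> Y v) ^ (2 * m) - (e \<bullet> Y v) ^ (2 * Suc m) \<partial>sphere_uniform)"
      by (rule integral_cong_AE)
         (use parseval in \<open>auto simp: sum_distrib_right[symmetric] left_diff_distrib power2_eq_square\<close>)
    also have "\<dots> = J m - J (Suc m)"
      unfolding J_def by (rule Bochner_Integration.integral_diff) (rule int1)+
    finally have "(N - 1) * J (Suc m) = (2 * real m + 1) * (J m - J (Suc m))"
      using e finB N by (simp add: of_nat_diff)
    then have "N * J (Suc m) + 2 * real m * J (Suc m) = (2 * real m + 1) * J m"
      by (simp add: algebra_simps)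
    moreover have "2 * real m * J (Suc m) \<ge> 0" using J0 by simp
    ultimately have "N * J (Suc m) \<le> (2 * real m + 1) * J m" by linarith
    then show ?thesis using N by (simp add: field_simps)
  qed
  have Jle: "J m \<le> (real m / N) ^ m" for m
  proof (induction m)
    case 0
    then show ?case by (simp add: J_def sphere_uniform.prob_space)
  next
    case (Suc m)
    have "J (Suc m) \<le> (2 * real m + 1) / N * (real m / N) ^ m"
      using Suc N by (intro order_trans[OF rec] mult_left_mono) auto
    also have "\<dots> = (2 * real m + 1) * real m ^ m / N ^ Suc m"
      by (simp add: power_divide)
    also have "\<dots> \<le> real (Suc m) ^ Suc m / N ^ Suc m"
      using N by (intro divide_right_mono Suc_power_self_ge) auto
    finally show ?case by (simp add: power_divide)
  qed
  define u' where "u' = u - (x \<bullet> u) *\<^sub>R x"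
  have xx: "x \<bullet> x = 1" using x by (simp add: norm_eq_1)
  have u': "u' \<in> W" by (simp add: W_def u'_def inner_diff xx)
  have "(\<integral>v. (u \<bullet> perp_dir x v) ^ (2 * m) \<partial>sphere_uniform) = (\<integral>v. (u' \<bullet> Y v) ^ (2 * m) \<partial>sphere_uniform)"
    using xY by (simp add: u'_def inner_diff_left) (simp add: Y_def)
  also have "\<dots> = norm u' ^ (2 * m) * J m" by (rule J_scale[OF u'])
  also have "\<dots> \<le> norm u ^ (2 * m) * (real m / N) ^ m"
  proof (intro mult_mono power_mono Jle)
    have "norm u' ^ 2 = norm u ^ 2 - (x \<bullet> u)\<^sup>2"
      unfolding power2_norm_eq_inner u'_def
      by (simp add: inner_diff_left inner_diff_right xx inner_commute[of u x] power2_eq_square)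
    then have "norm u' ^ 2 \<le> norm u ^ 2" by simp
    then show "norm u' \<le> norm u" by (rule power2_le_imp_le) simp
  qed (use J0 in auto)
  finally show ?thesis by (simp add: N_def mult.commute)
qed

section \<open>A moment inequality for mean zero functions\<close>

lemma integrable_sphere_uniform_continuous:
  fixes h :: "'a::euclidean_space \<Rightarrow> real"
  assumes "continuous_on (sphere 0 1) h"
  shows "integrable sphere_uniform h"
proof -
  have "bounded (h ` sphere 0 1)"
    using assms by (intro compact_imp_bounded compact_continuous_image) auto
  then obtain C where "\<And>x. x \<in> sphere 0 1 \<Longrightarrow> norm (h x) \<le> C" unfolding bounded_iff by force
  then show ?thesis
    by (intro sphere_uniform.integrable_const_bound[of _ C] borel_measurable_continuous_on_sphere assms AE_I2) auto
qed

lemma integrable_frame_continuous: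
  fixes h :: "'a::euclidean_space \<times> 'a \<Rightarrow> real"
  assumes h: "continuous_on UNIV h"
  shows "integrable sphere2 (\<lambda>p. h (frame p))"
proof -
  have "bounded (h ` (cball 0 1 \<times> cball 0 1))"
    by (intro compact_imp_bounded compact_continuous_image continuous_on_subset[OF h] compact_Times) auto
  then obtain C where C: "\<And>p. p \<in> cball 0 1 \<times> cball 0 1 \<Longrightarrow> norm (h p) \<le> C" unfolding bounded_iff by force
  show ?thesis
  proof (rule sphere_pair.P.integrable_const_bound[of _ C])
    show "AE p in sphere2. norm (h (frame p)) \<le> C"
      by (intro AE_I2 C) (auto simp: space_sphere2 frame_def norm_perp_dir_le)
    show "(\<lambda>p. h (frame p)) \<in> borel_measurable sphere2"
      by (rule measurable_compose[OF measurable_frame_sphere2 borel_measurable_continuous_onI[OF h]])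
  qed
qed

lemma integral_sphere2_fst:
  fixes h :: "'a::euclidean_space \<Rightarrow> real"
  assumes "continuous_on (sphere 0 1) h"
  shows "(\<integral>p. h (fst p) \<partial>(sphere2 :: ('a \<times> 'a) measure)) = (\<integral>x. h x \<partial>sphere_uniform)"
proof -
  have "(\<integral>x. h x \<partial>distr (sphere2 :: ('a \<times> 'a) measure) sphere_uniform fst)
      = (\<integral>p. h (fst p) \<partial>(sphere2 :: ('a \<times> 'a) measure))"
    by (rule integral_distr) (use assms in \<open>auto intro: borel_measurable_continuous_on_sphere\<close>)
  then show ?thesis by (simp add: sphere_uniform.distr_pair_fst)
qed

lemma measure_sphere_uniform_sphere: "measure sphere_uniform (sphere 0 1) = 1"
  using sphere_uniform.prob_space by simp

text \<open>The antipodal map preserves the measure and turns an angle t into pi - t.\<close>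

lemma integral_angle_between:
  fixes x :: "'a::euclidean_space"
  shows "(\<integral>v. angle_between x v \<partial>sphere_uniform) = pi / 2"
proof -
  have refl: "angle_between x (- v) = pi - angle_between x v" for v
  proof -
    have "max (-1) (min 1 (- (x \<bullet> v))) = - max (-1) (min 1 (x \<bullet> v))" by auto
    moreover have "\<bar>max (-1) (min 1 (x \<bullet> v))\<bar> \<le> 1" by auto
    ultimately show ?thesis by (simp add: angle_between_def arccos_minus_abs)
  qed
  have int: "integrable sphere_uniform (angle_between x)"
    by (rule sphere_uniform.integrable_const_bound[of _ pi])
       (use angle_between_bounds[of x] in \<open>auto simp: abs_of_nonneg\<close>)
  have "(\<integral>v. angle_between x v \<partial>sphere_uniform) = (\<integral>v. angle_between x (- v) \<partial>sphere_uniform)"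
    by (rule integral_sphere_orthogonal[symmetric]) (auto simp: orthogonal_transformation_def linear_uminus)
  also have "\<dots> = pi - (\<integral>v. angle_between x v \<partial>sphere_uniform)"
    using int by (simp add: refl measure_sphere_uniform_sphere)
  finally show ?thesis by simp
qed

lemma integral_angle_between_pair:
  "(\<integral>p. angle_between (fst p) (snd p) \<partial>(sphere2 :: ('a::euclidean_space \<times> 'a) measure)) = pi / 2"
proof -
  have "integrable (sphere2 :: ('a \<times> 'a) measure) (\<lambda>p. angle_between (fst p) (snd p))"
    by (rule sphere_pair.P.integrable_const_bound[of _ pi])
       (auto simp: abs_of_nonneg angle_between_bounds)
  from sphere_pair.integral_fst'[OF this] show ?thesis
    by (simp add: integral_angle_between case_prod_beta measure_sphere_uniform_sphere)
qed

lemma power_sum_le: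
  fixes a :: "nat \<Rightarrow> real"
  assumes "even p" "p > 0" "N > 0"
  shows "(\<Sum>i<N. a i) ^ p \<le> real N ^ (p - 1) * (\<Sum>i<N. a i ^ p)"
proof -
  have "(\<Sum>i<N. (1 / real N) *\<^sub>R a i) ^ p \<le> (\<Sum>i<N. (1 / real N) * a i ^ p)"
    using convex_on_sum[OF _ _ convex_power_even[OF assms(1)], of "{..<N}" "\<lambda>_. 1 / real N" a] assms
    by auto
  then have "(\<Sum>i<N. a i) ^ p / real N ^ p \<le> (\<Sum>i<N. a i ^ p) / real N"
    by (simp add: sum_divide_distrib[symmetric] power_divide)
  then have "(\<Sum>i<N. a i) ^ p \<le> real N ^ p / real N * (\<Sum>i<N. a i ^ p)"
    using assms by (simp add: field_simps)
  also have "real N ^ p / real N = real N ^ (p - 1)"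
    using assms by (simp add: power_diff)
  finally show ?thesis .
qed

text \<open>The exponents are p/(p-1) and p. This takes the place of Hoelder's inequality, since a
  weight depending on the angle can be inserted into \<open>b\<close>.\<close>

lemma Youngs_inequality_power:
  fixes a b :: real
  assumes "a \<ge> 0" "b \<ge> 0" "p \<ge> 2"
  shows "a ^ (p - 1) * b \<le> (1 - 1 / real p) * a ^ p + b ^ p / real p"
proof (cases "a = 0 \<or> b = 0")
  case True
  then show ?thesis using assms by (auto simp: zero_power)
next
  case False
  then have ab: "a > 0" "b > 0" using assms by auto
  have "(a ^ p) powr (1 - 1 / real p) * (b ^ p) powr (1 / real p)
      \<le> (1 - 1 / real p) * a ^ p + (1 / real p) * b ^ p"
    using ab assms by (intro Youngs_inequality_0) auto
  moreover have "(a ^ p) powr (1 - 1 / real p) = a ^ (p - 1)"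
    using ab assms by (simp add: powr_realpow[symmetric] powr_powr of_nat_diff right_diff_distrib)
  moreover have "(b ^ p) powr (1 / real p) = b"
    using ab assms by (simp add: powr_realpow[symmetric] powr_powr)
  ultimately show ?thesis by simp
qed

lemma integral_frame_rot:
  fixes h :: "'a::euclidean_space \<times> 'a \<Rightarrow> real"
  assumes dim: "DIM('a) \<ge> 2" and h: "continuous_on UNIV h"
  shows "(\<integral>p. h (rot \<alpha> (frame p)) \<partial>sphere2) = (\<integral>p. h (frame p) \<partial>sphere2)"
proof -
  have "continuous_on UNIV (\<lambda>(t::real, p). h p)"
    unfolding case_prod_beta by (rule continuous_on_compose2[OF h]) (auto intro: continuous_intros)
  from integral_angle_frame[OF dim this, of \<alpha>] show ?thesis
    by (simp only: lebesgue_integral_const sphere_pair.P.prob_space scaleR_one)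
qed

section \<open>Functions with a continuous gradient on the sphere\<close>

context
  fixes F :: "'a::euclidean_space \<Rightarrow> real" and G :: "'a \<Rightarrow> 'a"
  assumes dim: "DIM('a) \<ge> 2"
    and deriv: "\<And>x. x \<in> sphere 0 1 \<Longrightarrow> (F has_derivative (\<lambda>w. G x \<bullet> w)) (at x)"
    and contG: "continuous_on (sphere 0 1) G"
begin

lemma rot_fst_has_derivative:
  assumes p: "p \<in> frames"
  shows "((\<lambda>t. F (fst (rot t p))) has_real_derivative G (fst (rot t p)) \<bullet> snd (rot t p)) (at t)"
proof -
  have "fst (rot t p) \<in> sphere 0 1" using rot_frames[OF p, of t] by (auto simp: frames_def)
  then have F: "(F has_derivative (\<lambda>w. G (fst (rot t p)) \<bullet> w)) (at (fst (rot t p)))" by (rule deriv)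
  have "((\<lambda>t. fst (rot t p)) has_derivative (\<lambda>s. s *\<^sub>R snd (rot t p))) (at t)"
    unfolding rot_def by (auto intro!: derivative_eq_intros simp: algebra_simps)
  from has_derivative_compose[OF this F] show ?thesis
    unfolding has_field_derivative_def
    by (rule has_derivative_eq_rhs) (auto simp: mult.commute)
qed

text \<open>The arc of length \<open>\<theta>\<close> is cut into n equal pieces. Convexity costs
  n^(2m-1), and the n increments have the same law because the law of the frame is invariant under
  \<open>rot\<close>. So the moment is at most that of n times the increment over
  \<open>\<theta> / n\<close>, which tends to \<open>\<theta>\<close> times the derivative at the
  starting point. The extension \<open>F'\<close> gives meaning and continuity to the integrand at
  degenerate frames, where points leave the sphere.\<close>

lemma rot_moment_le:
  assumes F': "continuous_on UNIV F'" "\<And>x. x \<in> sphere 0 1 \<Longrightarrow> F' x = F x"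
    and \<theta>: "\<theta> > 0" and m: "m \<ge> 1"
  shows "(\<integral>p. (F' (fst (frame p)) - F' (fst (rot \<theta> (frame p)))) ^ (2 * m) \<partial>sphere2)
      \<le> \<theta> ^ (2 * m) * (\<integral>p. (G (fst p) \<bullet> perp_dir (fst p) (snd p)) ^ (2 * m) \<partial>sphere2)"
proof -
  define \<psi> where "\<psi> \<eta> p = (F' (fst p) - F' (fst (rot \<eta> p))) ^ (2 * m)" for \<eta> and p :: "'a \<times> 'a"
  have cF: "continuous_on UNIV (\<lambda>p. F' (fst (rot \<alpha> p)))" for \<alpha>
    by (rule continuous_on_compose2[OF F'(1)]) (auto intro!: continuous_intros continuous_rot)
  have c\<psi>: "continuous_on UNIV (\<psi> \<eta>)" for \<eta>
    using cF[of 0] cF[of \<eta>] unfolding \<psi>_def by (intro continuous_intros) (auto simp: rot_def)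
  have fr0: "rot 0 p = p" for p :: "'a \<times> 'a" by (simp add: rot_def)
  have "bounded (G ` sphere 0 1)"
    using contG by (intro compact_imp_bounded compact_continuous_image) auto
  then obtain L where L: "\<And>x. x \<in> sphere 0 1 \<Longrightarrow> norm (G x) \<le> L" unfolding bounded_iff by force
  have [measurable]: "G \<in> borel_measurable sphere_uniform"
    by (rule borel_measurable_continuous_on_sphere[OF contG])
  define a where "a N = (\<integral>p. (real (Suc N) * (F' (fst (frame p)) - F' (fst (rot (\<theta> / real (Suc N)) (frame p))))) ^ (2 * m) \<partial>sphere2)" for N
  have upper: "(\<integral>p. \<psi> \<theta> (frame p) \<partial>sphere2) \<le> a N" for N
  proof -
    define n where "n = Suc N"
    have n: "n > 0" by (simp add: n_def)
    define \<eta> where "\<eta> = \<theta> / real n"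
    have "\<psi> \<theta> p \<le> real n ^ (2 * m - 1) * (\<Sum>i<n. \<psi> \<eta> (rot (real i * \<eta>) p))" for p :: "'a \<times> 'a"
    proof -
      have "F' (fst p) - F' (fst (rot \<theta> p))
          = (\<Sum>i<n. F' (fst (rot (real i * \<eta>) p)) - F' (fst (rot (real (Suc i) * \<eta>) p)))"
        using n by (subst sum_lessThan_telescope') (simp add: fr0 \<eta>_def)
      also have "\<dots> = (\<Sum>i<n. F' (fst (rot (real i * \<eta>) p)) - F' (fst (rot \<eta> (rot (real i * \<eta>) p))))"
        by (simp add: rot_rot algebra_simps)
      finally show ?thesis
        unfolding \<psi>_def using power_sum_le[of "2 * m" n] m n by simp
    qed
    then have "(\<integral>p. \<psi> \<theta> (frame p) \<partial>sphere2)
        \<le> (\<integral>p. real n ^ (2 * m - 1) * (\<Sum>i<n. \<psi> \<eta> (rot (real i * \<eta>) (frame p))) \<partial>sphere2)"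
      by (intro integral_mono integrable_frame_continuous c\<psi> integrable_mult_right Bochner_Integration.integrable_sum
          integrable_frame_continuous[where h = "\<lambda>p. \<psi> \<eta> (rot _ p)"] continuous_on_compose2[OF c\<psi> continuous_rot]) auto
    also have "\<dots> = real n ^ (2 * m - 1) * (\<Sum>i<n. (\<integral>p. \<psi> \<eta> (frame p) \<partial>sphere2))"
      by (subst integral_mult_right_zero, subst Bochner_Integration.integral_sum)
         (auto simp: integral_frame_rot[OF dim c\<psi>]
           intro!: integrable_frame_continuous[where h = "\<lambda>p. \<psi> \<eta> (rot _ p)"] continuous_on_compose2[OF c\<psi> continuous_rot])
    also have "\<dots> = real n ^ (2 * m) * (\<integral>p. \<psi> \<eta> (frame p) \<partial>sphere2)"
      using m by (cases m) (auto simp: power_add)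
    also have "\<dots> = a N"
      by (simp add: a_def n_def[symmetric] \<psi>_def \<eta>_def power_mult_distrib)
    finally show ?thesis .
  qed
  have lim: "a \<longlonglongrightarrow> (\<integral>p. (- \<theta> * (G (fst p) \<bullet> perp_dir (fst p) (snd p))) ^ (2 * m) \<partial>sphere2)"
    unfolding a_def
  proof (rule integral_dominated_convergence[where w = "\<lambda>_. (\<theta> * L) ^ (2 * m)"])
    show "(\<lambda>p. (- \<theta> * (G (fst p) \<bullet> perp_dir (fst p) (snd p))) ^ (2 * m)) \<in> borel_measurable sphere2"
      by measurable
    show "(\<lambda>p. (real (Suc N) * (F' (fst (frame p)) - F' (fst (rot (\<theta> / real (Suc N)) (frame p))))) ^ (2 * m)) \<in> borel_measurable sphere2" for N
    proof -
      have "(\<lambda>p. F' (fst (rot \<alpha> (frame p)))) \<in> borel_measurable sphere2" for \<alpha>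
        by (rule measurable_compose[OF measurable_frame_sphere2 borel_measurable_continuous_onI[OF cF]])
      from this[of 0] this[of "\<theta> / real (Suc N)"] show ?thesis unfolding fr0 by measurable
    qed
    have eqF: "F' (fst (rot t p)) = F (fst (rot t p))" if "p \<in> frames" for t p
      using rot_frames[OF that, of t] by (intro F'(2)) (auto simp: frames_def)
    show "AE p in sphere2. (\<lambda>N. (real (Suc N) * (F' (fst (frame p)) - F' (fst (rot (\<theta> / real (Suc N)) (frame p))))) ^ (2 * m))
        \<longlonglongrightarrow> (- \<theta> * (G (fst p) \<bullet> perp_dir (fst p) (snd p))) ^ (2 * m)"
      using AE_frame[OF dim]
    proof eventually_elim
      fix p :: "'a \<times> 'a" assume p: "frame p \<in> frames"
      define g where "g t = F (fst (rot t (frame p)))" for t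
      define D where "D = G (fst p) \<bullet> perp_dir (fst p) (snd p)"
      have "(g has_real_derivative D) (at 0)"
        using rot_fst_has_derivative[OF p, of 0] unfolding g_def D_def fr0 by (simp add: frame_def)
      then have "((\<lambda>h. (g (0 + h) - g 0) / h) \<longlongrightarrow> D) (at 0)" by (simp add: DERIV_def)
      moreover have "filterlim (\<lambda>N. \<theta> / real (Suc N)) (at 0) sequentially"
        unfolding filterlim_at using \<theta> LIMSEQ_Suc[OF lim_const_over_n[of \<theta>]] by simp
      ultimately have "(\<lambda>N. (g (0 + \<theta> / real (Suc N)) - g 0) / (\<theta> / real (Suc N))) \<longlonglongrightarrow> D"
        by (rule filterlim_compose)
      then have "(\<lambda>N. - \<theta> * ((g (0 + \<theta> / real (Suc N)) - g 0) / (\<theta> / real (Suc N)))) \<longlonglongrightarrow> - \<theta> * D"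
        by (rule tendsto_mult_left)
      moreover have "- \<theta> * ((g (0 + \<theta> / real (Suc N)) - g 0) / (\<theta> / real (Suc N)))
          = real (Suc N) * (g 0 - g (\<theta> / real (Suc N)))" for N
      proof -
        have "- \<theta> * (z / (\<theta> / n)) = n * - z" for z n using \<theta> by simp
        from this[of "g (0 + \<theta> / real (Suc N)) - g 0" "real (Suc N)"] show ?thesis
          by (simp only: minus_diff_eq add_0)
      qed
      ultimately have "(\<lambda>N. real (Suc N) * (g 0 - g (\<theta> / real (Suc N)))) \<longlonglongrightarrow> - \<theta> * D"
        by (simp only:)
      then have "(\<lambda>N. (real (Suc N) * (g 0 - g (\<theta> / real (Suc N)))) ^ (2 * m)) \<longlonglongrightarrow> (- \<theta> * D) ^ (2 * m)"
        by (rule tendsto_power)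
      then show "(\<lambda>N. (real (Suc N) * (F' (fst (frame p)) - F' (fst (rot (\<theta> / real (Suc N)) (frame p))))) ^ (2 * m))
        \<longlonglongrightarrow> (- \<theta> * (G (fst p) \<bullet> perp_dir (fst p) (snd p))) ^ (2 * m)"
        using eqF[OF p, of 0] by (simp add: g_def D_def eqF[OF p] fr0)
    qed
    \<comment> \<open>By the mean value theorem along the great circle, n times the increment over
      \<open>\<theta> / n\<close> is bounded by \<open>\<theta> * L\<close> for every n. This needs
      a genuine frame, hence only almost every \<open>p\<close>.\<close>
    show "AE p in sphere2. norm ((real (Suc N) * (F' (fst (frame p)) - F' (fst (rot (\<theta> / real (Suc N)) (frame p))))) ^ (2 * m))
        \<le> (\<theta> * L) ^ (2 * m)" for N
      using AE_frame[OF dim]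
    proof eventually_elim
      fix p :: "'a \<times> 'a" assume p: "frame p \<in> frames"
      define t where "t = \<theta> / real (Suc N)"
      have t: "t > 0" using \<theta> by (simp add: t_def)
      obtain z where z: "F (fst (rot t (frame p))) - F (fst (rot 0 (frame p)))
          = (t - 0) * (G (fst (rot z (frame p))) \<bullet> snd (rot z (frame p)))"
        using MVT2[OF t, of "\<lambda>t. F (fst (rot t (frame p)))" "\<lambda>z. G (fst (rot z (frame p))) \<bullet> snd (rot z (frame p))"]
          rot_fst_has_derivative[OF p] by blast
      have rz: "norm (fst (rot z (frame p))) = 1" "norm (snd (rot z (frame p))) = 1"
        using rot_frames[OF p, of z] by (auto simp: frames_def)
      have "\<bar>G (fst (rot z (frame p))) \<bullet> snd (rot z (frame p))\<bar> \<le> L"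
        using Cauchy_Schwarz_ineq2[of "G (fst (rot z (frame p)))" "snd (rot z (frame p))"] L[of "fst (rot z (frame p))"] rz by simp
      then have "\<bar>F (fst (rot t (frame p))) - F (fst (rot 0 (frame p)))\<bar> \<le> t * L"
        using t by (simp add: z abs_mult)
      then have "real (Suc N) * \<bar>F (fst (rot t (frame p))) - F (fst (rot 0 (frame p)))\<bar> \<le> real (Suc N) * (t * L)"
        by (intro mult_left_mono) auto
      also have "\<dots> = \<theta> * L" by (simp add: t_def)
      finally have "\<bar>real (Suc N) * (F (fst (rot 0 (frame p))) - F (fst (rot t (frame p))))\<bar> \<le> \<theta> * L"
        by (simp only: abs_mult abs_minus_commute abs_of_nat)
      then have "\<bar>real (Suc N) * (F (fst (rot 0 (frame p))) - F (fst (rot t (frame p))))\<bar> ^ (2 * m) \<le> (\<theta> * L) ^ (2 * m)"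
        by (intro power_mono) auto
      then show "norm ((real (Suc N) * (F' (fst (frame p)) - F' (fst (rot (\<theta> / real (Suc N)) (frame p))))) ^ (2 * m))
        \<le> (\<theta> * L) ^ (2 * m)"
        using eqF[OF p, of 0] by (simp add: fr0 eqF[OF p] t_def power_abs)
    qed
  qed simp
  have "(\<integral>p. \<psi> \<theta> (frame p) \<partial>sphere2) \<le> (\<integral>p. (- \<theta> * (G (fst p) \<bullet> perp_dir (fst p) (snd p))) ^ (2 * m) \<partial>sphere2)"
    by (rule LIMSEQ_le_const[OF lim]) (use upper in blast)
  then show ?thesis by (simp add: \<psi>_def power_mult_distrib)
qed

text \<open>For fixed \<open>x\<close>, integration over the second point is the coordinate moment
  with \<open>u = G x\<close>.\<close>

lemma gradient_moment_le:
  "(\<integral>p. (G (fst p) \<bullet> perp_dir (fst p) (snd p)) ^ (2 * m) \<partial>sphere2)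
    \<le> (real m / (real DIM('a) - 1)) ^ m * (\<integral>x. norm (G x) ^ (2 * m) \<partial>sphere_uniform)"
proof -
  have [measurable]: "G \<in> borel_measurable sphere_uniform"
    by (rule borel_measurable_continuous_on_sphere[OF contG])
  have "bounded (G ` sphere 0 1)"
    using contG by (intro compact_imp_bounded compact_continuous_image) auto
  then obtain L where L: "\<And>x. x \<in> sphere 0 1 \<Longrightarrow> norm (G x) \<le> L" unfolding bounded_iff by force
  have le: "\<bar>G x \<bullet> perp_dir x v\<bar> \<le> L" if "norm x = 1" for x v
    using Cauchy_Schwarz_ineq2[of "G x" "perp_dir x v"] L[of x] that
      mult_left_mono[OF norm_perp_dir_le[of x v] norm_ge_zero[of "G x"]] by simp
  have int: "integrable sphere2 (\<lambda>p. (G (fst p) \<bullet> perp_dir (fst p) (snd p)) ^ (2 * m))"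
    by (rule sphere_pair.P.integrable_const_bound[of _ "L ^ (2 * m)"])
       (auto simp: space_sphere2 power_abs intro!: AE_I2 power_mono le simp del: power_even_abs)
  have "(\<integral>p. (G (fst p) \<bullet> perp_dir (fst p) (snd p)) ^ (2 * m) \<partial>sphere2)
      = (\<integral>x. (\<integral>v. (G x \<bullet> perp_dir x v) ^ (2 * m) \<partial>sphere_uniform) \<partial>sphere_uniform)"
    using sphere_pair.integral_fst'[OF int] by simp
  also have "\<dots> \<le> (\<integral>x. (real m / (real DIM('a) - 1)) ^ m * norm (G x) ^ (2 * m) \<partial>sphere_uniform)"
  proof (rule integral_mono)
    show "integrable sphere_uniform (\<lambda>x. \<integral>v. (G x \<bullet> perp_dir x v) ^ (2 * m) \<partial>sphere_uniform)"
      using sphere_pair.integrable_fst'[OF int] by simp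
    show "integrable sphere_uniform (\<lambda>x. (real m / (real DIM('a) - 1)) ^ m * norm (G x) ^ (2 * m))"
      by (intro integrable_sphere_uniform_continuous continuous_intros contG)
  qed (use perp_coordinate_moment[OF dim] in auto)
  finally show ?thesis by simp
qed

text \<open>With A the p-th moment of F minus its mean, R that of the derivative in the tangent
  direction, and c = pi/2, the argument yields A <= (1 - 1/p) A + c^p R / p. Subtracting the first
  term leaves A <= c^p R, and \<open>gradient_moment_le\<close> bounds R.\<close>

theorem moment_inequality:
  assumes m: "m \<ge> 1"
  shows "(\<integral>x. (F x - (\<integral>z. F z \<partial>sphere_uniform)) ^ (2 * m) \<partial>sphere_uniform)
    \<le> ((pi / 2)\<^sup>2 * real m / (real DIM('a) - 1)) ^ m * (\<integral>x. norm (G x) ^ (2 * m) \<partial>sphere_uniform)"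
proof -
  have contF: "continuous_on (sphere 0 1) F"
    using deriv by (intro continuous_at_imp_continuous_on) (blast intro: has_derivative_continuous)
  \<comment> \<open>\<open>integral_angle_frame\<close> takes functions continuous on the whole
    space, while \<open>F\<close> is controlled on the sphere only.\<close>
  obtain F' where F': "continuous_on UNIV F'" "\<And>x. x \<in> sphere 0 1 \<Longrightarrow> F' x = F x"
    using Tietze_unbounded[OF contF, of UNIV] by auto
  define \<mu> where "\<mu> = (\<integral>z. F z \<partial>sphere_uniform)"
  define p where "p = 2 * m"
  have p: "p \<ge> 2" "even p" using m by (auto simp: p_def)
  define u where "u x = F' x - \<mu>" for x
  define A where "A = (\<integral>x. u x ^ p \<partial>sphere_uniform)"
  define R where "R = (\<integral>q. (G (fst q) \<bullet> perp_dir (fst q) (snd q)) ^ p \<partial>sphere2)"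
  define c where "c = pi / 2"
  have c: "c > 0" by (simp add: c_def)
  \<comment> \<open>For an increment D at angle t, Young's inequality is applied to |u|^(p-1) and
    (c/t) |D|. As the p-th moment of D is at most t^p R, the powers of t cancel and the bound is t
    times this number. The mean of t is c, which removes the denominator.\<close>
  define \<kappa> where "\<kappa> = ((1 - 1 / real p) * A + c ^ p * R / real p) / c"
  have cF': "continuous_on S F'" for S using F'(1) continuous_on_subset by blast
  have intF: "integrable sphere_uniform F'" by (rule integrable_sphere_uniform_continuous[OF cF'])
  have \<mu>: "\<mu> = (\<integral>z. F' z \<partial>sphere_uniform)"
    unfolding \<mu>_def by (rule Bochner_Integration.integral_cong) (auto simp: F')
  have A_eq: "(\<integral>x. (F x - \<mu>) ^ (2 * m) \<partial>sphere_uniform) = A"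
    unfolding A_def u_def p_def by (rule Bochner_Integration.integral_cong) (auto simp: F')
  define H where "H t q = u (fst q) ^ (p - 1) * (F' (fst q) - F' (fst (rot t q)))" for t and q :: "'a \<times> 'a"
  have cH: "continuous_on UNIV (\<lambda>(t, q). H t q)"
  proof -
    have "continuous_on UNIV (\<lambda>z :: real \<times> 'a \<times> 'a. F' (fst (snd z)))"
         "continuous_on UNIV (\<lambda>z :: real \<times> 'a \<times> 'a. F' (fst (rot (fst z) (snd z))))"
      unfolding rot_def
      by (rule continuous_on_compose2[OF F'(1)], auto intro!: continuous_intros)+
    then show ?thesis unfolding H_def u_def case_prod_beta by (intro continuous_intros)
  qed
  have inner: "(\<integral>q. H t (frame q) \<partial>sphere2) \<le> t * \<kappa>" if t: "t \<ge> 0" for t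
  proof (cases "t = 0")
    case True
    then show ?thesis by (simp add: H_def rot_def)
  next
    case False
    with t have t: "t > 0" by simp
    define D where "D q = F' (fst q) - F' (fst (rot t q))" for q :: "'a \<times> 'a"
    have cD: "continuous_on UNIV D" unfolding D_def
      by (intro continuous_intros continuous_on_compose2[OF F'(1)] continuous_rot) auto
    have cu: "continuous_on UNIV (\<lambda>q :: 'a \<times> 'a. u (fst q))" unfolding u_def
      by (intro continuous_intros continuous_on_compose2[OF F'(1)]) auto
    have "H t q \<le> (t / c) * ((1 - 1 / real p) * u (fst q) ^ p + (c / t) ^ p / real p * D q ^ p)" for q
    proof -
      have "H t q \<le> \<bar>u (fst q)\<bar> ^ (p - 1) * \<bar>D q\<bar>"
        unfolding H_def D_def[symmetric] by (metis abs_ge_self abs_mult power_abs)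
      also have "\<dots> = (t / c) * (\<bar>u (fst q)\<bar> ^ (p - 1) * (c / t * \<bar>D q\<bar>))"
        using t c by simp
      also have "\<dots> \<le> (t / c) * ((1 - 1 / real p) * \<bar>u (fst q)\<bar> ^ p + (c / t * \<bar>D q\<bar>) ^ p / real p)"
        using t c p by (intro mult_left_mono Youngs_inequality_power) auto
      also have "(c / t * \<bar>D q\<bar>) ^ p = (c / t) ^ p * D q ^ p"
        by (simp only: power_mult_distrib power_even_abs[OF p(2)])
      finally show ?thesis by (simp only: power_even_abs[OF p(2)] times_divide_eq_left)
    qed
    note H_le = this
    have iH: "integrable sphere2 (\<lambda>q. H t (frame q))"
      by (rule integrable_frame_continuous)
         (unfold H_def D_def[symmetric], intro continuous_on_mult continuous_on_power cu cD)
    have iu: "integrable sphere2 (\<lambda>q :: 'a \<times> 'a. u (fst (frame q)) ^ p)"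
      by (rule integrable_frame_continuous[OF continuous_on_power[OF cu]])
    have iD: "integrable sphere2 (\<lambda>q. D (frame q) ^ p)"
      by (rule integrable_frame_continuous[OF continuous_on_power[OF cD]])
    have "(\<integral>q. H t (frame q) \<partial>sphere2)
        \<le> (\<integral>q. (t / c) * ((1 - 1 / real p) * u (fst (frame q)) ^ p + (c / t) ^ p / real p * D (frame q) ^ p) \<partial>sphere2)"
      by (rule integral_mono[OF iH _ H_le])
         (intro integrable_mult_right Bochner_Integration.integrable_add iu iD)
    also have "\<dots> = (t / c) * ((1 - 1 / real p) * (\<integral>q. u (fst (frame q :: 'a \<times> 'a)) ^ p \<partial>sphere2)
        + (c / t) ^ p / real p * (\<integral>q. D (frame q) ^ p \<partial>sphere2))"
      using iu iD by simp
    also have "(\<integral>q. u (fst (frame q :: 'a \<times> 'a)) ^ p \<partial>sphere2) = A"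
      unfolding A_def using integral_sphere2_fst[of "\<lambda>x. u x ^ p"]
      by (simp add: frame_def u_def continuous_intros cF')
    also have "(t / c) * ((1 - 1 / real p) * A + (c / t) ^ p / real p * (\<integral>q. D (frame q) ^ p \<partial>sphere2))
        \<le> (t / c) * ((1 - 1 / real p) * A + (c / t) ^ p / real p * (t ^ p * R))"
    proof (intro mult_left_mono add_left_mono)
      show "(\<integral>q. D (frame q) ^ p \<partial>sphere2) \<le> t ^ p * R"
        unfolding D_def R_def p_def by (rule rot_moment_le[OF F' t m])
    qed (use t c in auto)
    also have "(c / t) ^ p / real p * (t ^ p * R) = c ^ p * R / real p"
      using t by (simp add: power_divide)
    finally show ?thesis using c by (simp add: \<kappa>_def)
  qed
  have "A = (\<integral>x. (\<integral>v. u x ^ (p - 1) * (F' x - F' v) \<partial>sphere_uniform) \<partial>sphere_uniform)"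
    unfolding A_def
  proof (rule Bochner_Integration.integral_cong[OF refl])
    fix x :: 'a
    have "(\<integral>v. F' x - F' v \<partial>sphere_uniform) = u x"
      using intF by (simp add: u_def \<mu> measure_sphere_uniform_sphere)
    then show "u x ^ p = (\<integral>v. u x ^ (p - 1) * (F' x - F' v) \<partial>sphere_uniform)"
      using p by (simp add: power_eq_if)
  qed
  also have "\<dots> = (\<integral>q. u (fst q) ^ (p - 1) * (F' (fst q) - F' (snd q)) \<partial>sphere2)"
  proof -
    have c1: "continuous_on UNIV (\<lambda>q :: 'a \<times> 'a. u (fst q) ^ (p - 1) * (F' (fst q) - F' (snd q)))"
      unfolding u_def by (intro continuous_intros continuous_on_compose2[OF F'(1)]) auto
    have "bounded ((\<lambda>q. u (fst q) ^ (p - 1) * (F' (fst q) - F' (snd q))) ` (sphere (0::'a) 1 \<times> sphere (0::'a) 1))"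
      by (intro compact_imp_bounded compact_continuous_image continuous_on_subset[OF c1] compact_Times) auto
    then obtain C where C: "\<And>q. q \<in> sphere (0::'a) 1 \<times> sphere (0::'a) 1 \<Longrightarrow> norm (u (fst q) ^ (p - 1) * (F' (fst q) - F' (snd q))) \<le> C"
      unfolding bounded_iff by force
    have "integrable (sphere2 :: ('a \<times> 'a) measure) (\<lambda>q. u (fst q) ^ (p - 1) * (F' (fst q) - F' (snd q)))"
      by (rule sphere_pair.P.integrable_const_bound[of _ C, OF AE_I2[OF C]
            measurable_compose[OF measurable_sphere2_borel borel_measurable_continuous_onI[OF c1]]])
         (simp add: space_sphere2)
    from sphere_pair.integral_fst'[OF this] show ?thesis by simp
  qed
  also have "\<dots> = (\<integral>q. H (angle_between (fst q) (snd q)) (frame q) \<partial>sphere2)"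
  proof (rule Bochner_Integration.integral_cong[OF refl])
    fix q :: "'a \<times> 'a" assume "q \<in> space sphere2"
    then have "norm (fst q) = 1" "norm (snd q) = 1" by (auto simp: space_sphere2)
    from frame_decomposition[OF this] show "u (fst q) ^ (p - 1) * (F' (fst q) - F' (snd q)) = H (angle_between (fst q) (snd q)) (frame q)"
      by (simp add: H_def) (simp add: frame_def)
  qed
  also have "\<dots> = (\<integral>q. (\<integral>q'. H (angle_between (fst q) (snd q)) (frame q') \<partial>sphere2) \<partial>(sphere2 :: ('a \<times> 'a) measure))"
    using integral_angle_frame[OF dim cH, of 0] by (simp add: rot_def)
  also have "\<dots> \<le> (\<integral>q. angle_between (fst q) (snd q) * \<kappa> \<partial>(sphere2 :: ('a \<times> 'a) measure))"
  proof -
    have int: "integrable (sphere2 :: ('a \<times> 'a) measure) (\<lambda>q. angle_between (fst q) (snd q) * \<kappa>)"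
      by (intro integrable_mult_left sphere_pair.P.integrable_const_bound[of _ pi]) (auto simp: abs_of_nonneg angle_between_bounds)
    show ?thesis
    proof (cases "integrable (sphere2 :: ('a \<times> 'a) measure) (\<lambda>q. (\<integral>q'. H (angle_between (fst q) (snd q)) (frame q') \<partial>sphere2))")
      case True
      then show ?thesis using int by (intro integral_mono inner angle_between_bounds)
    next
      \<comment> \<open>A function that is not integrable has integral 0 by convention, so
        \<open>0 \<le> \<kappa>\<close> suffices here.\<close>
      case False
      have "0 \<le> \<kappa>" 
      proof -
        have "A \<ge> 0" "R \<ge> 0" unfolding A_def R_def using p by (auto intro!: integral_nonneg_AE AE_I2)
        then show ?thesis using c p by (simp add: \<kappa>_def)
      qed
      then have "0 \<le> (\<integral>q. angle_between (fst q) (snd q) * \<kappa> \<partial>(sphere2 :: ('a \<times> 'a) measure))"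
        by (intro integral_nonneg_AE AE_I2) (simp add: angle_between_bounds)
      then show ?thesis using False by (simp add: not_integrable_integral_eq)
    qed
  qed
  also have "\<dots> = c * \<kappa>" by (simp add: integral_angle_between_pair c_def)
  also have "\<dots> = (1 - 1 / real p) * A + c ^ p * R / real p"
    using c by (simp add: \<kappa>_def)
  finally have "A \<le> c ^ p * R"
    using p by (simp add: field_simps)
  also have "\<dots> \<le> c ^ p * ((real m / (real DIM('a) - 1)) ^ m * (\<integral>x. norm (G x) ^ (2 * m) \<partial>sphere_uniform))"
    using c unfolding R_def p_def by (intro mult_left_mono gradient_moment_le) auto
  also have "\<dots> = ((pi / 2)\<^sup>2 * real m / (real DIM('a) - 1)) ^ m * (\<integral>x. norm (G x) ^ (2 * m) \<partial>sphere_uniform)"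
    unfolding c_def p_def power_mult mult.assoc[symmetric] power_mult_distrib[symmetric] by simp
  finally show ?thesis by (simp only: A_eq[symmetric] \<mu>_def)
qed

end

section \<open>Derivative forms and their norms\<close>

text \<open>\<open>C_smooth_on\<close> speaks of derivatives along the axes only. The passage from
  \<open>x\<close> to \<open>y\<close> switches on one coordinate of \<open>y - x\<close> after
  another and applies a mean value estimate to each. All intermediate points are within
  \<open>norm (y - x)\<close> of \<open>x\<close>, because their displacement is componentwise no
  larger.\<close>

lemma has_derivative_partial_derivatives:
  fixes g :: "real^'n \<Rightarrow> real" and D :: "'n \<Rightarrow> real^'n \<Rightarrow> real"
  assumes U: "open U" "x \<in> U"
    and D: "\<And>i y. y \<in> U \<Longrightarrow> ((\<lambda>t. g (y + t *\<^sub>R axis i 1)) has_real_derivative D i y) (at 0)"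
    and cont: "\<And>i. continuous_on U (D i)"
  shows "(g has_derivative (\<lambda>w. (\<chi> i. D i x) \<bullet> w)) (at x)"
  unfolding has_derivative_at_alt
proof (intro conjI allI impI)
  show "bounded_linear ((\<bullet>) (\<chi> i. D i x))" by (rule bounded_linear_inner_right)
  fix e :: real assume e: "e > 0"
  define e' where "e' = e / real CARD('n)"
  have e': "e' > 0" using e by (simp add: e'_def)
  have "\<forall>\<^sub>F y in nhds x. \<bar>D i y - D i x\<bar> < e'" for i
  proof -
    have "(D i \<longlongrightarrow> D i x) (nhds x)"
      using cont[of i] U by (simp add: continuous_on_eq_continuous_at isCont_def tendsto_nhds_iff)
    from tendstoD[OF this e'] show ?thesis by (simp add: dist_real_def)
  qed
  then have "\<forall>\<^sub>F y in nhds x. y \<in> U \<and> (\<forall>i. \<bar>D i y - D i x\<bar> < e')"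
    using U by (intro eventually_conj eventually_all_finite eventually_nhds_in_open)
  then obtain d where d: "d > 0" "\<And>y i. dist y x < d \<Longrightarrow> y \<in> U \<and> \<bar>D i y - D i x\<bar> < e'"
    unfolding eventually_nhds_metric by blast
  have "norm (g y - g x - (\<chi> i. D i x) \<bullet> (y - x)) \<le> e * norm (y - x)" if y: "norm (y - x) < d" for y
  proof -
    define h where "h = y - x"
    define hh where "hh A = (\<chi> i. if i \<in> A then h $ i else 0)" for A
    have near: "dist (x + hh A + t *\<^sub>R axis i 1) x < d" if "i \<notin> A" "\<bar>t\<bar> \<le> \<bar>h $ i\<bar>" for A i t
    proof -
      have "norm (hh A + t *\<^sub>R axis i 1) \<le> norm h"
        by (rule norm_le_componentwise_cart) (use that in \<open>auto simp: hh_def axis_def\<close>)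
      then show ?thesis using y by (simp add: dist_norm h_def algebra_simps)
    qed
    have "\<bar>g (x + hh A) - g x - (\<Sum>i\<in>A. h $ i * D i x)\<bar> \<le> (\<Sum>i\<in>A. e' * \<bar>h $ i\<bar>)" if "finite A" for A
      using that
    proof (induction A)
      case empty
      have "hh {} = 0" by (simp add: hh_def vec_eq_iff)
      then show ?case by simp
    next
      case (insert i A)
      have hi: "hh (insert i A) = hh A + (h $ i) *\<^sub>R axis i 1"
        using insert(2) by (auto simp: hh_def vec_eq_iff axis_def)
      define z where "z = x + hh A"
      define \<phi> where "\<phi> t = g (z + t *\<^sub>R axis i 1) - t * D i x" for t
      have "norm (\<phi> (h $ i) - \<phi> 0) \<le> e' * norm (h $ i - 0)"
      proof (rule field_differentiable_bound[of "cball 0 \<bar>h $ i\<bar>"])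
        fix t :: real assume "t \<in> cball 0 \<bar>h $ i\<bar>"
        then have "dist (z + t *\<^sub>R axis i 1) x < d"
          unfolding z_def using insert(2) by (intro near) auto
        from d(2)[OF this, of i] have U': "z + t *\<^sub>R axis i 1 \<in> U"
          and De: "\<bar>D i (z + t *\<^sub>R axis i 1) - D i x\<bar> < e'" by auto
        have "((\<lambda>s. g (z + s *\<^sub>R axis i 1)) has_real_derivative D i (z + t *\<^sub>R axis i 1)) (at t)"
          using D[OF U'] DERIV_shift[of "\<lambda>s. g (z + s *\<^sub>R axis i 1)" "D i (z + t *\<^sub>R axis i 1)" 0 t]
          by (simp add: algebra_simps)
        then show "(\<phi> has_field_derivative D i (z + t *\<^sub>R axis i 1) - D i x) (at t within cball 0 \<bar>h $ i\<bar>)"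
          unfolding \<phi>_def by (auto intro!: derivative_eq_intros intro: has_field_derivative_at_within)
        show "norm (D i (z + t *\<^sub>R axis i 1) - D i x) \<le> e'" using De by simp
      qed auto
      then have "\<bar>g (x + hh (insert i A)) - g (x + hh A) - h $ i * D i x\<bar> \<le> e' * \<bar>h $ i\<bar>"
        by (simp add: \<phi>_def hi z_def algebra_simps)
      then show ?case using insert by simp
    qed
    moreover have "x + hh UNIV = y" by (simp add: hh_def h_def vec_eq_iff)
    ultimately have "\<bar>g y - g x - (\<Sum>i\<in>UNIV. h $ i * D i x)\<bar> \<le> (\<Sum>i\<in>UNIV. e' * \<bar>h $ i\<bar>)"
      using finite_class.finite_UNIV by metis
    also have "\<dots> \<le> (\<Sum>i\<in>(UNIV::'n set). e' * norm h)"
      using e' by (intro sum_mono mult_left_mono component_le_norm_cart) auto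
    also have "\<dots> = e * norm h" by (simp add: e'_def)
    finally show ?thesis by (simp add: h_def inner_vec_def mult.commute)
  qed
  then show "\<exists>d>0. \<forall>y. norm (y - x) < d \<longrightarrow> norm (g y - g x - (\<chi> i. D i x) \<bullet> (y - x)) \<le> e * norm (y - x)"
    using d(1) by blast
qed

lemma finite_lists_length [simp]: "finite {is :: 'n::finite list. length is = k}"
  using finite_lists_length_eq[of "UNIV :: 'n set" k] by simp

text \<open>The gradient in \<open>x\<close> of the form at fixed vectors \<open>v\<close>. The new
  index comes first, as in \<open>partials\<close>, so paired with \<open>w\<close> it gives the
  form of the next order with \<open>w\<close> as vector number 0 and the others shifted:
  \<open>case_nat w v\<close>.\<close>

definition form_gradient :: "nat \<Rightarrow> (real^'n \<Rightarrow> real) \<Rightarrow> real^'n \<Rightarrow> (nat \<Rightarrow> real^'n) \<Rightarrow> real^'n" where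
  "form_gradient k f x v = (\<chi> i. \<Sum>is | length is = k. partials (i # is) f x * (\<Prod>j<k. v j $ (is ! j)))"

lemma form_gradient_inner:
  fixes v :: "nat \<Rightarrow> real^'n"
  shows "form_gradient k f x v \<bullet> w = deriv_form (Suc k) f x (case_nat w v)"
proof -
  let ?v = "case_nat w v"
  have lists: "{is :: 'n list. length is = Suc k} = (\<lambda>(i, is). i # is) ` (UNIV \<times> {is. length is = k})"
    by (auto simp: length_Suc_conv)
  have inj: "inj_on (\<lambda>(i, is). i # is) (UNIV \<times> {is :: 'n list. length is = k})"
    by (auto simp: inj_on_def)
  have "deriv_form (Suc k) f x ?v
      = (\<Sum>(i, is)\<in>UNIV \<times> {is. length is = k}. partials (i # is) f x * (\<Prod>j<Suc k. ?v j $ ((i # is) ! j)))"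
    unfolding deriv_form_def lists by (subst sum.reindex[OF inj]) (simp add: case_prod_beta)
  also have "\<dots> = (\<Sum>i\<in>UNIV. \<Sum>is | length is = k. partials (i # is) f x * (\<Prod>j<Suc k. ?v j $ ((i # is) ! j)))"
    by (simp add: sum.cartesian_product)
  also have "\<dots> = (\<Sum>i\<in>UNIV. \<Sum>is | length is = k. (partials (i # is) f x * (\<Prod>j<k. v j $ (is ! j))) * w $ i)"
    by (simp only: prod.lessThan_Suc_shift nat.case nth_Cons_0 nth_Cons_Suc) (simp add: ac_simps)
  finally show ?thesis
    by (simp add: form_gradient_def inner_vec_def sum_distrib_right)
qed

lemma deriv_form_le_op_norm:
  assumes "\<And>j. j < k \<Longrightarrow> norm (v j) = 1"
  shows "deriv_form k f x v \<le> op_norm k f x"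
  unfolding op_norm_def by (rule cSup_upper[OF _ bdd_above_deriv_form]) (use assms in blast)

text \<open>The gradient is tested against its own direction as the additional unit vector. This is
  the link from order \<open>k\<close> to order \<open>k + 1\<close>.\<close>

lemma norm_form_gradient_le:
  assumes v: "\<And>j. j < k \<Longrightarrow> norm (v j) = 1"
  shows "norm (form_gradient k f x v) \<le> op_norm (Suc k) f x"
proof -
  let ?g = "form_gradient k f x v"
  obtain w where w: "norm w = 1" "?g \<bullet> w = norm ?g"
  proof (cases "?g = 0")
    case True
    then show ?thesis using that[of "axis undefined 1"] by simp
  next
    case False
    then show ?thesis
      using that[of "?g /\<^sub>R norm ?g"] by (simp add: dot_square_norm power2_eq_square)
  qed
  have "deriv_form (Suc k) f x (case_nat w v) \<le> op_norm (Suc k) f x"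
    by (rule deriv_form_le_op_norm) (use v w in \<open>auto split: nat.split\<close>)
  then show ?thesis using w by (simp add: form_gradient_inner)
qed

text \<open>In order 0 the form is \<open>f x\<close> without an absolute value and may be negative,
  hence the \<open>Suc\<close>.\<close>

lemma op_norm_Suc_nonneg: "0 \<le> op_norm (Suc k) f x"
  using order_trans[OF norm_ge_zero norm_form_gradient_le[of k "\<lambda>_. axis undefined 1" f x]] by simp

lemma op_norm_least:
  assumes "\<And>v. (\<And>j. j < k \<Longrightarrow> norm (v j) = 1) \<Longrightarrow> deriv_form k f x v \<le> c"
  shows "op_norm k f x \<le> c"
  unfolding op_norm_def
proof (rule cSup_least)
  have "deriv_form k f x (\<lambda>_. axis undefined 1) \<in> {deriv_form k f x v | v. \<forall>j<k. norm (v j) = 1}" by force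
  then show "{deriv_form k f x v | v. \<forall>j<k. norm (v j) = 1} \<noteq> {}" by blast
qed (use assms in blast)

lemma abs_prod_components_le:
  fixes v :: "nat \<Rightarrow> real^'n"
  assumes "\<And>j. j < k \<Longrightarrow> norm (v j) = 1"
  shows "\<bar>\<Prod>j<k. v j $ (is ! j)\<bar> \<le> 1"
  unfolding abs_prod using assms
  by (auto intro!: prod_le_1 component_le_norm_cart[THEN order_trans])

lemma op_norm_diff_le:
  "op_norm k f x \<le> op_norm k f y + (\<Sum>is | length is = k. \<bar>partials is f x - partials is f y\<bar>)"
proof (rule op_norm_least)
  fix v :: "nat \<Rightarrow> real^'a" assume v: "\<And>j. j < k \<Longrightarrow> norm (v j) = 1"
  have "deriv_form k f x v - deriv_form k f y v
      = (\<Sum>is | length is = k. (partials is f x - partials is f y) * (\<Prod>j<k. v j $ (is ! j)))"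
    by (simp add: deriv_form_def sum_subtractf left_diff_distrib)
  also have "\<dots> \<le> (\<Sum>is | length is = k. \<bar>partials is f x - partials is f y\<bar>)"
  proof (rule sum_mono)
    fix "is" :: "'a list"
    have "\<bar>(partials is f x - partials is f y) * (\<Prod>j<k. v j $ (is ! j))\<bar> \<le> \<bar>partials is f x - partials is f y\<bar> * 1"
      unfolding abs_mult by (intro mult_left_mono abs_prod_components_le v) auto
    then show "(partials is f x - partials is f y) * (\<Prod>j<k. v j $ (is ! j)) \<le> \<bar>partials is f x - partials is f y\<bar>"
      by simp
  qed
  finally show "deriv_form k f x v \<le> op_norm k f y + (\<Sum>is | length is = k. \<bar>partials is f x - partials is f y\<bar>)"
    using deriv_form_le_op_norm[of k v f y] v by simp
qed

section \<open>Regularity of the forms and of the operator norm of a smooth function\<close>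

context
  fixes f :: "real^'n \<Rightarrow> real" and U :: "(real^'n) set" and d :: nat
  assumes smooth: "C_smooth_on d f U" and U: "open U"
begin

lemma continuous_on_partials: "length is \<le> d \<Longrightarrow> continuous_on U (partials is f)"
  using smooth by (simp add: C_smooth_on_def)

lemma continuous_on_op_norm:
  assumes k: "k \<le> d"
  shows "continuous_on U (op_norm k f)"
  unfolding continuous_on_def
proof
  fix x assume x: "x \<in> U"
  have "((\<lambda>y. op_norm k f y - op_norm k f x) \<longlongrightarrow> 0) (at x within U)"
  proof (rule Lim_null_comparison[OF always_eventually])
    show "\<forall>y. norm (op_norm k f y - op_norm k f x) \<le> (\<Sum>is | length is = k. \<bar>partials is f y - partials is f x\<bar>)"
    proof
      fix y
      show "norm (op_norm k f y - op_norm k f x) \<le> (\<Sum>is | length is = k. \<bar>partials is f y - partials is f x\<bar>)"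
        using op_norm_diff_le[of k f x y] op_norm_diff_le[of k f y x]
        by (simp add: abs_minus_commute[of "partials _ f x"] abs_le_iff)
    qed
    have "((\<lambda>y. \<Sum>is | length is = k. \<bar>partials is f y - partials is f x\<bar>)
        \<longlongrightarrow> (\<Sum>is | length is = k. \<bar>partials is f x - partials is f x\<bar>)) (at x within U)"
      using continuous_on_partials k x
      by (intro tendsto_intros) (auto simp: continuous_on_def)
    then show "((\<lambda>y. \<Sum>is | length is = k. \<bar>partials is f y - partials is f x\<bar>) \<longlongrightarrow> 0) (at x within U)"
      by simp
  qed
  then show "(op_norm k f \<longlongrightarrow> op_norm k f x) (at x within U)"
    by (simp add: LIM_zero_iff)
qed

lemma continuous_on_form_gradient:
  assumes k: "k < d"
  shows "continuous_on U (\<lambda>x. form_gradient k f x v)"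
  unfolding form_gradient_def
  by (intro continuous_intros continuous_on_partials) (use k in auto)

lemma deriv_form_has_derivative:
  assumes k: "k < d" and x: "x \<in> U"
  shows "((\<lambda>x. deriv_form k f x v) has_derivative (\<lambda>w. form_gradient k f x v \<bullet> w)) (at x)"
  unfolding form_gradient_def
proof (rule has_derivative_partial_derivatives[OF U x])
  fix i y assume y: "y \<in> U"
  have "((\<lambda>t. partials is f (y + t *\<^sub>R axis i 1)) has_real_derivative partials (i # is) f y) (at 0)"
    if "length is = k" for "is"
    using smooth k y that by (auto simp: C_smooth_on_def intro!: DERIV_deriv_iff_field_differentiable[THEN iffD2])
  then show "((\<lambda>t. deriv_form k f (y + t *\<^sub>R axis i 1) v) has_real_derivative
      (\<Sum>is | length is = k. partials (i # is) f y * (\<Prod>j<k. v j $ (is ! j)))) (at 0)"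
    unfolding deriv_form_def by (intro DERIV_sum DERIV_cmult_right) auto
next
  fix i
  show "continuous_on U (\<lambda>x. \<Sum>is | length is = k. partials (i # is) f x * (\<Prod>j<k. v j $ (is ! j)))"
    by (intro continuous_intros continuous_on_partials) (use k in auto)
qed

end

section \<open>Smooth approximation of the operator norm\<close>

text \<open>\<open>F\<close> is the function ln (\<Sum> exp (\<beta> g_i)) / \<beta>. Its gradient
  is a convex combination of the gradients \<open>D i\<close>, so every common bound
  \<open>b\<close> survives, and it exceeds the maximum of the g_i by at most ln (card V) /
  \<beta>.\<close>

lemma softmax_approximation:
  fixes g :: "'i \<Rightarrow> 'a::euclidean_space \<Rightarrow> real" and D :: "'i \<Rightarrow> 'a \<Rightarrow> 'a"
  assumes V: "finite V" "V \<noteq> {}" and \<delta>: "\<delta> > 0"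
    and deriv: "\<And>i x. i \<in> V \<Longrightarrow> x \<in> S \<Longrightarrow> (g i has_derivative (\<lambda>w. D i x \<bullet> w)) (at x)"
    and cont: "\<And>i. i \<in> V \<Longrightarrow> continuous_on S (D i)"
    and bound: "\<And>i x. i \<in> V \<Longrightarrow> x \<in> S \<Longrightarrow> norm (D i x) \<le> b x"
  obtains F G where "\<And>x. x \<in> S \<Longrightarrow> (F has_derivative (\<lambda>w. G x \<bullet> w)) (at x)" "continuous_on S G"
    "\<And>x. x \<in> S \<Longrightarrow> norm (G x) \<le> b x"
    "\<And>i x. i \<in> V \<Longrightarrow> g i x \<le> F x"
    "\<And>x c. (\<And>i. i \<in> V \<Longrightarrow> g i x \<le> c) \<Longrightarrow> F x \<le> c + \<delta>"
proof -
  \<comment> \<open>The added 1 keeps \<open>\<beta>\<close> positive when \<open>V\<close> is a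
    singleton.\<close>
  define \<beta> where "\<beta> = (ln (real (card V)) + 1) / \<delta>"
  have card: "card V \<ge> 1" using V by (simp add: Suc_leI card_gt_0_iff)
  have lncard: "ln (real (card V)) \<ge> 0" using card by simp
  have \<beta>: "\<beta> > 0" using lncard \<delta> by (simp add: \<beta>_def)
  have \<beta>\<delta>: "ln (real (card V)) / \<beta> \<le> \<delta>"
    using lncard \<delta> \<beta> by (simp add: \<beta>_def field_simps)
  define Z where "Z x = (\<Sum>i\<in>V. exp (\<beta> * g i x))" for x
  define F where "F x = ln (Z x) / \<beta>" for x
  define G where "G x = (\<Sum>i\<in>V. (exp (\<beta> * g i x) / Z x) *\<^sub>R D i x)" for x
  have Z: "Z x > 0" for x unfolding Z_def using V by (intro sum_pos) auto
  show ?thesis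
  proof (rule that[of F G])
    fix x assume x: "x \<in> S"
    have "(Z has_derivative (\<lambda>w. \<Sum>i\<in>V. exp (\<beta> * g i x) * (\<beta> * (D i x \<bullet> w)))) (at x)"
      unfolding Z_def[abs_def]
      by (rule has_derivative_sum) (auto intro!: derivative_eq_intros deriv x)
    from has_derivative_ln[OF Z this] have "((\<lambda>x. ln (Z x) * inverse \<beta>) has_derivative
        (\<lambda>w. (\<Sum>i\<in>V. exp (\<beta> * g i x) * (\<beta> * (D i x \<bullet> w))) * inverse (Z x) * inverse \<beta>)) (at x)"
      by (intro has_derivative_mult_left) (simp add: ac_simps divide_inverse)
    then show "(F has_derivative (\<lambda>w. G x \<bullet> w)) (at x)"
      unfolding F_def[abs_def] divide_inverse
      by (rule has_derivative_eq_rhs)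
         (use \<beta> in \<open>auto simp: G_def inner_sum_left sum_distrib_right divide_inverse intro!: sum.cong\<close>)
    have "norm (G x) \<le> (\<Sum>i\<in>V. (exp (\<beta> * g i x) / Z x) * b x)"
      unfolding G_def
    proof (intro sum_norm_le)
      fix i assume "i \<in> V"
      then show "norm ((exp (\<beta> * g i x) / Z x) *\<^sub>R D i x) \<le> exp (\<beta> * g i x) / Z x * b x"
        using bound[OF _ x] Z[of x] by (simp add: divide_right_mono mult_left_mono)
    qed
    also have "\<dots> = Z x / Z x * b x"
      by (simp add: Z_def flip: sum_distrib_right sum_divide_distrib)
    also have "\<dots> = b x" using Z[of x] by simp
    finally show "norm (G x) \<le> b x" .
  next
    have cg: "continuous_on S (g i)" if "i \<in> V" for i
      using deriv[OF that] by (intro continuous_at_imp_continuous_on) (blast intro: has_derivative_continuous)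
    have cZ: "continuous_on S Z"
      unfolding Z_def[abs_def] by (intro continuous_intros cg)
    have Z0: "Z x \<noteq> 0" for x using Z[of x] by simp
    show "continuous_on S G"
      unfolding G_def[abs_def]
      by (intro continuous_on_sum continuous_on_scaleR continuous_on_divide continuous_on_exp
          continuous_on_mult_left cg cZ cont ballI Z0)
  next
    fix i x assume i: "i \<in> V"
    have "exp (\<beta> * g i x) \<le> Z x" unfolding Z_def by (rule member_le_sum) (use i V in auto)
    then have "\<beta> * g i x \<le> ln (Z x)" using Z[of x] by (simp add: ln_ge_iff)
    then show "g i x \<le> F x" using \<beta> by (simp add: F_def field_simps)
  next
    fix x c assume c: "\<And>i. i \<in> V \<Longrightarrow> g i x \<le> c"
    have "Z x \<le> (\<Sum>i\<in>V. exp (\<beta> * c))"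
      unfolding Z_def using c \<beta> by (intro sum_mono) auto
    then have "ln (Z x) \<le> ln (real (card V) * exp (\<beta> * c))"
      using Z[of x] by (simp add: ln_mono)
    also have "\<dots> = ln (real (card V)) + \<beta> * c"
      using card by (simp add: ln_mult_pos)
    finally have "F x \<le> (ln (real (card V)) + \<beta> * c) / \<beta>"
      using \<beta> unfolding F_def by (intro divide_right_mono) auto
    also have "\<dots> \<le> c + \<delta>" using \<beta>\<delta> \<beta> by (simp add: add_divide_distrib)
    finally show "F x \<le> c + \<delta>" .
  qed
qed

lemma deriv_form_diff_le:
  fixes f :: "real^'n \<Rightarrow> real"
  assumes v: "\<And>j. j < k \<Longrightarrow> norm (v j) = 1" and w: "\<And>j. j < k \<Longrightarrow> norm (w j) = 1"
    and vw: "\<And>j. j < k \<Longrightarrow> norm (v j - w j) \<le> \<eta>"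
  shows "deriv_form k f x v - deriv_form k f x w \<le> (\<Sum>is | length is = k. \<bar>partials is f x\<bar>) * (real k * \<eta>)"
proof -
  have "deriv_form k f x v - deriv_form k f x w
      = (\<Sum>is | length is = k. partials is f x * ((\<Prod>j<k. v j $ (is ! j)) - (\<Prod>j<k. w j $ (is ! j))))"
    by (simp add: deriv_form_def sum_subtractf right_diff_distrib)
  also have "\<dots> \<le> (\<Sum>is | length is = k. \<bar>partials is f x\<bar> * (real k * \<eta>))"
  proof (rule sum_mono)
    fix "is" :: "'n list"
    have "\<bar>(\<Prod>j<k. v j $ (is ! j)) - (\<Prod>j<k. w j $ (is ! j))\<bar> \<le> (\<Sum>j<k. \<bar>v j $ (is ! j) - w j $ (is ! j)\<bar>)"
    proof -
      have "\<bar>v j $ (is ! j)\<bar> \<le> 1" "\<bar>w j $ (is ! j)\<bar> \<le> 1" if "j < k" for j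
        using component_le_norm_cart[of "v j" "is ! j"] component_le_norm_cart[of "w j" "is ! j"] v w that by auto
      then show ?thesis
        using norm_prod_diff[of "{..<k}" "\<lambda>j. v j $ (is ! j)" "\<lambda>j. w j $ (is ! j)"] by simp
    qed
    also have "\<dots> \<le> (\<Sum>j<k. \<eta>)"
    proof (rule sum_mono)
      fix j assume "j \<in> {..<k}"
      then show "\<bar>v j $ (is ! j) - w j $ (is ! j)\<bar> \<le> \<eta>"
        using component_le_norm_cart[of "v j - w j" "is ! j"] vw[of j] by simp
    qed
    finally have "\<bar>(\<Prod>j<k. v j $ (is ! j)) - (\<Prod>j<k. w j $ (is ! j))\<bar> \<le> real k * \<eta>" by simp
    then have "\<bar>partials is f x * ((\<Prod>j<k. v j $ (is ! j)) - (\<Prod>j<k. w j $ (is ! j)))\<bar> \<le> \<bar>partials is f x\<bar> * (real k * \<eta>)"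
      unfolding abs_mult by (intro mult_left_mono) auto
    then show "partials is f x * ((\<Prod>j<k. v j $ (is ! j)) - (\<Prod>j<k. w j $ (is ! j))) \<le> \<bar>partials is f x\<bar> * (real k * \<eta>)"
      by simp
  qed
  finally show ?thesis by (simp add: sum_distrib_right)
qed

text \<open>The supremum over all tuples of unit vectors is replaced by a maximum over tuples from a
  finite net, with an error at most \<open>\<delta>\<close> uniformly on the sphere, since the
  partial derivatives are bounded there. The soft maximum over these tuples errs by at most
  \<open>\<delta>\<close> in the other direction.\<close>

lemma op_norm_smooth_approximation:
  fixes f :: "real^'n \<Rightarrow> real"
  assumes smooth: "C_smooth_on d f U" and U: "open U" "sphere 0 1 \<subseteq> U" and k: "k < d" and \<delta>: "\<delta> > 0"
  obtains F G where "\<And>x. x \<in> sphere 0 1 \<Longrightarrow> (F has_derivative (\<lambda>w. G x \<bullet> w)) (at x)"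
    "continuous_on (sphere 0 1) G" "\<And>x. x \<in> sphere 0 1 \<Longrightarrow> norm (G x) \<le> op_norm (Suc k) f x"
    "\<And>x. x \<in> sphere 0 1 \<Longrightarrow> \<bar>F x - op_norm k f x\<bar> \<le> \<delta>"
proof -
  let ?S = "sphere (0 :: real^'n) 1"
  have "continuous_on ?S (\<lambda>x. \<Sum>is | length is = k. \<bar>partials is f x\<bar>)"
    using continuous_on_subset[OF continuous_on_partials[OF smooth U(1)] U(2)] k
    by (intro continuous_intros) auto
  then have "bounded ((\<lambda>x. \<Sum>is | length is = k. \<bar>partials is f x\<bar>) ` ?S)"
    by (intro compact_imp_bounded compact_continuous_image) auto
  then obtain B where "\<forall>x\<in>?S. norm (\<Sum>is | length is = k. \<bar>partials is f x\<bar>) \<le> B"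
    unfolding bounded_iff by force
  then have B: "(\<Sum>is | length is = k. \<bar>partials is f x\<bar>) \<le> B" if "x \<in> ?S" for x
    using that by force
  have Bk: "0 \<le> B * real k"
    using order_trans[OF _ B[of "axis undefined 1"]] by (intro mult_nonneg_nonneg) (auto intro: sum_nonneg)
  \<comment> \<open>The added 1 covers \<open>k = 0\<close> and \<open>B = 0\<close>.\<close>
  define \<eta> where "\<eta> = \<delta> / (B * real k + 1)"
  have \<eta>: "\<eta> > 0" using \<delta> Bk by (simp add: \<eta>_def)
  have B\<eta>: "B * (real k * \<eta>) \<le> \<delta>"
    using \<delta> Bk by (simp add: \<eta>_def field_simps)
  obtain E where E: "finite E" "E \<subseteq> ?S" "?S \<subseteq> (\<Union>e\<in>E. ball e \<eta>)"
    using seq_compact_imp_totally_bounded[OF compact_imp_seq_compact[OF compact_sphere]] \<eta> by metis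
  have "axis undefined 1 \<in> ?S" by simp
  then have "E \<noteq> {}" using E(3) by auto
  \<comment> \<open>Extensional functions keep \<open>V\<close> finite; the form ignores the vectors
    with index at least \<open>k\<close>.\<close>
  define V where "V = PiE {..<k} (\<lambda>_. E)"
  have V: "finite V" "V \<noteq> {}"
    unfolding V_def using E(1) \<open>E \<noteq> {}\<close> by (auto simp: finite_PiE PiE_eq_empty_iff)
  have Vn: "norm (v j) = 1" if "v \<in> V" "j < k" for v j
    using that E(2) by (auto simp: V_def PiE_def Pi_def subset_iff)
  obtain F G where FG: "\<And>x. x \<in> ?S \<Longrightarrow> (F has_derivative (\<lambda>w. G x \<bullet> w)) (at x)" "continuous_on ?S G"
    "\<And>x. x \<in> ?S \<Longrightarrow> norm (G x) \<le> op_norm (Suc k) f x"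
    "\<And>v x. v \<in> V \<Longrightarrow> deriv_form k f x v \<le> F x"
    "\<And>x c. (\<And>v. v \<in> V \<Longrightarrow> deriv_form k f x v \<le> c) \<Longrightarrow> F x \<le> c + \<delta>"
  proof (rule softmax_approximation[OF V \<delta>, of ?S "\<lambda>v x. deriv_form k f x v" "\<lambda>v x. form_gradient k f x v" "op_norm (Suc k) f"])
    show "((\<lambda>x. deriv_form k f x v) has_derivative (\<lambda>w. form_gradient k f x v \<bullet> w)) (at x)" if "x \<in> ?S" for v x
      using that U(2) by (intro deriv_form_has_derivative[OF smooth U(1) k]) auto
    show "continuous_on ?S (\<lambda>x. form_gradient k f x v)" for v
      by (rule continuous_on_subset[OF continuous_on_form_gradient[OF smooth U(1) k] U(2)])
    show "norm (form_gradient k f x v) \<le> op_norm (Suc k) f x" if "v \<in> V" for v x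
      by (rule norm_form_gradient_le) (use Vn that in auto)
  qed (blast intro: that)
  show ?thesis
  proof (rule that[OF FG(1-3)])
    fix x assume x: "x \<in> ?S"
    have "F x \<le> op_norm k f x + \<delta>"
      by (rule FG(5)) (use Vn in \<open>auto intro: deriv_form_le_op_norm\<close>)
    moreover have "op_norm k f x \<le> F x + \<delta>"
    proof (rule op_norm_least)
      fix v :: "nat \<Rightarrow> real^'n" assume v: "\<And>j. j < k \<Longrightarrow> norm (v j) = 1"
      have "\<exists>e\<in>E. norm (v j - e) \<le> \<eta>" if "j < k" for j
      proof -
        have "v j \<in> ?S" using v that by simp
        then obtain e where "e \<in> E" "v j \<in> ball e \<eta>" using E(3) by blast
        then show ?thesis by (intro bexI[of _ e]) (auto simp: dist_norm norm_minus_commute)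
      qed
      then obtain w0 where w0: "\<And>j. j < k \<Longrightarrow> w0 j \<in> E \<and> norm (v j - w0 j) \<le> \<eta>" by metis
      define w where "w = restrict w0 {..<k}"
      have wV: "w \<in> V" using w0 by (auto simp: w_def V_def)
      have "deriv_form k f x v - deriv_form k f x w \<le> (\<Sum>is | length is = k. \<bar>partials is f x\<bar>) * (real k * \<eta>)"
        by (rule deriv_form_diff_le) (use v Vn[OF wV] w0 in \<open>auto simp: w_def\<close>)
      also have "\<dots> \<le> B * (real k * \<eta>)" using B[OF x] \<eta> by (intro mult_right_mono) auto
      finally show "deriv_form k f x v \<le> F x + \<delta>" using FG(4)[OF wV, of x] B\<eta> by simp
    qed
    ultimately show "\<bar>F x - op_norm k f x\<bar> \<le> \<delta>" by linarith
  qed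
qed

section \<open>Iterating the moment inequality\<close>

text \<open>(c + t)/(c + u) is a convex combination of 1 and t/u with weights c/(c + u) and u/(c +
  u). Integrated with \<open>u\<close> a bound on the L^p norm of t, this becomes Minkowski's
  inequality for the sum of a constant and a function.\<close>

lemma power_add_le:
  fixes c t u :: real
  assumes "even p" "p > 0" "c \<ge> 0" "u > 0"
  shows "(c + t) ^ p \<le> (c + u) ^ (p - 1) * (c + u * (t / u) ^ p)"
proof -
  define l where "l = u / (c + u)"
  have cu: "c + u > 0" using assms by simp
  have l: "0 \<le> l" "l \<le> 1" using assms by (auto simp: l_def)
  have 1: "(1 - l) *\<^sub>R 1 + l *\<^sub>R (t / u) = (c + t) / (c + u)"
  proof -
    have "1 - l = c / (c + u)" using cu by (simp add: l_def field_simps)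
    then show ?thesis using assms cu by (simp add: l_def add_divide_distrib)
  qed
  have "((1 - l) *\<^sub>R 1 + l *\<^sub>R (t / u)) ^ p \<le> (1 - l) * 1 ^ p + l * (t / u) ^ p"
    using convex_onD[OF convex_power_even[OF assms(1)] l, of 1 "t / u"] by simp
  then have "(c + t) ^ p / (c + u) ^ p \<le> (c + u * (t / u) ^ p) / (c + u)"
  proof -
    have "1 - l = c / (c + u)" using cu by (simp add: l_def field_simps)
    moreover have "l * (t / u) ^ p = u * (t / u) ^ p / (c + u)" by (simp add: l_def)
    ultimately show ?thesis
      using \<open>_ \<le> (1 - l) * 1 ^ p + l * (t / u) ^ p\<close> unfolding 1
      by (simp add: add_divide_distrib[of c "u * (t / u) ^ p" "c + u"] power_divide[of "c + t" "c + u"])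
  qed
  then have "(c + t) ^ p \<le> (c + u) ^ p * ((c + u * (t / u) ^ p) / (c + u))"
    using cu by (simp add: pos_divide_le_eq mult.commute)
  also have "\<dots> = (c + u) ^ p / (c + u) * (c + u * (t / u) ^ p)" by simp
  also have "(c + u) ^ p / (c + u) = (c + u) ^ (p - 1)"
    using cu assms(2) by (cases p) auto
  finally show ?thesis .
qed

lemma sphere_moment_add_const:
  fixes X u :: "'a::euclidean_space \<Rightarrow> real"
  assumes cX: "continuous_on (sphere 0 1) X" and cu: "continuous_on (sphere 0 1) u"
    and le: "\<And>x. x \<in> sphere 0 1 \<Longrightarrow> \<bar>X x\<bar> \<le> c + \<bar>u x\<bar>"
    and p: "even p" "p > 0" and c: "c \<ge> 0" and N: "N > 0"
    and u: "(\<integral>x. u x ^ p \<partial>sphere_uniform) \<le> N ^ p"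
  shows "(\<integral>x. X x ^ p \<partial>sphere_uniform) \<le> (c + N) ^ p"
proof -
  have iu: "integrable sphere_uniform (\<lambda>x. u x ^ p)"
    by (intro integrable_sphere_uniform_continuous continuous_intros cu)
  have "(\<integral>x. X x ^ p \<partial>sphere_uniform) \<le> (\<integral>x. (c + N) ^ (p - 1) * (c + N / N ^ p * u x ^ p) \<partial>sphere_uniform)"
  proof (rule integral_mono)
    show "integrable sphere_uniform (\<lambda>x. X x ^ p)"
      by (intro integrable_sphere_uniform_continuous continuous_intros cX)
    show "integrable sphere_uniform (\<lambda>x. (c + N) ^ (p - 1) * (c + N / N ^ p * u x ^ p))"
      using iu by (intro integrable_mult_right Bochner_Integration.integrable_add) auto
    fix x :: 'a assume "x \<in> space sphere_uniform"
    then have "\<bar>X x\<bar> ^ p \<le> (c + \<bar>u x\<bar>) ^ p" by (intro power_mono le) auto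
    also have "\<dots> \<le> (c + N) ^ (p - 1) * (c + N * (\<bar>u x\<bar> / N) ^ p)"
      by (rule power_add_le[OF p c N])
    finally show "X x ^ p \<le> (c + N) ^ (p - 1) * (c + N / N ^ p * u x ^ p)"
      using p by (simp add: power_even_abs power_divide)
  qed
  also have "\<dots> = (c + N) ^ (p - 1) * (c + N / N ^ p * (\<integral>x. u x ^ p \<partial>sphere_uniform))"
    using iu by (simp add: measure_sphere_uniform_sphere)
  also have "\<dots> \<le> (c + N) ^ (p - 1) * (c + N / N ^ p * N ^ p)"
    using c N u by (intro mult_left_mono add_left_mono) auto
  also have "\<dots> = (c + N) ^ p"
    using p N by (cases p) auto
  finally show ?thesis .
qed

lemma sphere_expectation_le_L2:
  fixes X :: "'a::euclidean_space \<Rightarrow> real"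
  assumes cX: "continuous_on (sphere 0 1) X"
  shows "(\<integral>x. X x \<partial>sphere_uniform) \<le> sqrt (\<integral>x. (X x)\<^sup>2 \<partial>sphere_uniform)"
proof (rule real_le_rsqrt)
  have i: "integrable sphere_uniform X" "integrable sphere_uniform (\<lambda>x. (X x)\<^sup>2)"
    by (intro integrable_sphere_uniform_continuous continuous_intros cX)+
  have "0 \<le> sphere_uniform.variance X" by (rule sphere_uniform.variance_positive)
  then show "(\<integral>x. X x \<partial>sphere_uniform)\<^sup>2 \<le> (\<integral>x. (X x)\<^sup>2 \<partial>sphere_uniform)"
    using sphere_uniform.variance_eq[OF i] by simp
qed

section \<open>Descent from order \<open>d\<close> to the function itself\<close>

context
  fixes f :: "real^'n \<Rightarrow> real" and U :: "(real^'n) set" and d m :: nat and T :: real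
  assumes card: "CARD('n) \<ge> 2" and smooth: "C_smooth_on d f U"
    and U: "open U" "sphere 0 1 \<subseteq> U" and m: "m \<ge> 1"
    and T: "T > 0" "T\<^sup>2 = (pi / 2)\<^sup>2 * real m / (real CARD('n) - 1)"
begin

lemma gradient_moment_step:
  fixes F :: "real^'n \<Rightarrow> real"
  assumes F: "\<And>x. x \<in> sphere 0 1 \<Longrightarrow> (F has_derivative (\<lambda>w. G x \<bullet> w)) (at x)"
    and G: "continuous_on (sphere 0 1) G" "\<And>x. x \<in> sphere 0 1 \<Longrightarrow> norm (G x) \<le> op_norm k f x"
    and k: "k \<le> d"
    and N: "(\<integral>x. op_norm k f x ^ (2 * m) \<partial>sphere_uniform) \<le> N ^ (2 * m)"
  shows "(\<integral>x. (F x - (\<integral>z. F z \<partial>sphere_uniform)) ^ (2 * m) \<partial>sphere_uniform) \<le> (T * N) ^ (2 * m)"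
proof -
  have "DIM(real^'n) \<ge> 2" using card by simp
  from moment_inequality[OF this F G(1) m]
  have "(\<integral>x. (F x - (\<integral>z. F z \<partial>sphere_uniform)) ^ (2 * m) \<partial>sphere_uniform)
      \<le> (T\<^sup>2) ^ m * (\<integral>x. norm (G x) ^ (2 * m) \<partial>sphere_uniform)"
    by (simp add: T(2))
  also have "\<dots> \<le> (T\<^sup>2) ^ m * (\<integral>x. op_norm k f x ^ (2 * m) \<partial>sphere_uniform)"
  proof (intro mult_left_mono integral_mono)
    show "integrable sphere_uniform (\<lambda>x. norm (G x) ^ (2 * m))"
      by (intro integrable_sphere_uniform_continuous continuous_intros G)
    show "integrable sphere_uniform (\<lambda>x. op_norm k f x ^ (2 * m))"
      by (intro integrable_sphere_uniform_continuous continuous_intros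
          continuous_on_subset[OF continuous_on_op_norm[OF smooth U(1) k] U(2)])
  qed (use G in \<open>auto intro: power_mono\<close>)
  also have "\<dots> \<le> (T\<^sup>2) ^ m * N ^ (2 * m)" by (intro mult_left_mono N) auto
  also have "\<dots> = (T * N) ^ (2 * m)" by (simp add: power_mult_distrib power_mult)
  finally show ?thesis .
qed

text \<open>The mean of the operator norm is at most its L^2 norm, hence at most \<open>c\<close>,
  and its fluctuation is controlled by the next order. The operator norm itself need not be
  differentiable, so the estimate is made for a smooth approximation, and the error tends to 0.
  Nonnegativity turns the upper bound into one for the absolute value.\<close>

lemma op_norm_moment_step:
  assumes k: "k < d" and N: "N > 0"
    and IH: "(\<integral>x. op_norm (Suc k) f x ^ (2 * m) \<partial>sphere_uniform) \<le> N ^ (2 * m)"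
    and c: "c \<ge> 0" "op_norm_L2 k f \<le> c" and pos: "\<And>x. 0 \<le> op_norm k f x"
  shows "(\<integral>x. op_norm k f x ^ (2 * m) \<partial>sphere_uniform) \<le> (c + T * N) ^ (2 * m)"
proof -
  have co: "continuous_on (sphere 0 1) (op_norm k f)"
    using k by (intro continuous_on_subset[OF continuous_on_op_norm[OF smooth U(1)] U(2)]) auto
  have mean: "(\<integral>x. op_norm k f x \<partial>sphere_uniform) \<le> c"
    using sphere_expectation_le_L2[OF co] c(2) by (simp add: op_norm_L2_def)
  \<comment> \<open>One \<open>\<delta>\<close> comes from the pointwise approximation, the other
    from the mean of \<open>F\<close>.\<close>
  have bound: "(\<integral>x. op_norm k f x ^ (2 * m) \<partial>sphere_uniform) \<le> (c + 2 * \<delta> + T * N) ^ (2 * m)"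
    if \<delta>: "\<delta> > 0" for \<delta>
  proof -
    obtain F G where FG: "\<And>x. x \<in> sphere 0 1 \<Longrightarrow> (F has_derivative (\<lambda>w. G x \<bullet> w)) (at x)"
      "continuous_on (sphere 0 1) G" "\<And>x. x \<in> sphere 0 1 \<Longrightarrow> norm (G x) \<le> op_norm (Suc k) f x"
      "\<And>x. x \<in> sphere 0 1 \<Longrightarrow> \<bar>F x - op_norm k f x\<bar> \<le> \<delta>"
      by (rule op_norm_smooth_approximation[OF smooth U k \<delta>]) blast
    define \<mu> where "\<mu> = (\<integral>z. F z \<partial>sphere_uniform)"
    have cF: "continuous_on (sphere 0 1) F"
      using FG(1) by (intro continuous_at_imp_continuous_on) (blast intro: has_derivative_continuous)
    have "\<mu> \<le> (\<integral>x. op_norm k f x + \<delta> \<partial>sphere_uniform)"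
      unfolding \<mu>_def
    proof (rule integral_mono)
      show "integrable sphere_uniform F" "integrable sphere_uniform (\<lambda>x. op_norm k f x + \<delta>)"
        by (intro integrable_sphere_uniform_continuous continuous_intros cF co)+
      show "F x \<le> op_norm k f x + \<delta>" if "x \<in> space sphere_uniform" for x
        using FG(4)[of x] that by (simp add: abs_le_iff)
    qed
    also have "\<dots> \<le> c + \<delta>"
      using mean integrable_sphere_uniform_continuous[OF co] by (simp add: measure_sphere_uniform_sphere)
    finally have \<mu>: "\<mu> \<le> c + \<delta>" .
    show ?thesis
    proof (rule sphere_moment_add_const[where u = "\<lambda>x. F x - \<mu>"])
      show "(\<integral>x. (F x - \<mu>) ^ (2 * m) \<partial>sphere_uniform) \<le> (T * N) ^ (2 * m)"
        unfolding \<mu>_def by (rule gradient_moment_step[OF FG(1-3) _ IH]) (use k in auto)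
      show "\<bar>op_norm k f x\<bar> \<le> c + 2 * \<delta> + \<bar>F x - \<mu>\<bar>" if "x \<in> sphere 0 1" for x
        using FG(4)[OF that] \<mu> pos[of x] by (simp add: abs_le_iff) linarith
      show "continuous_on (sphere 0 1) (\<lambda>x. F x - \<mu>)" by (intro continuous_intros cF)
    qed (use co m c \<delta> T N in auto)
  qed
  have "(\<lambda>j. (c + 2 * inverse (real (Suc j)) + T * N) ^ (2 * m)) \<longlonglongrightarrow> (c + 2 * 0 + T * N) ^ (2 * m)"
    by (intro tendsto_intros LIMSEQ_inverse_real_of_nat)
  then have "(\<integral>x. op_norm k f x ^ (2 * m) \<partial>sphere_uniform) \<le> (c + 2 * 0 + T * N) ^ (2 * m)"
    by (rule LIMSEQ_le_const) (use bound in auto)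
  then show ?thesis by simp
qed

text \<open>Induction downwards from order d. The bounds N(r) at order d - r obey N(0) = 1 and
  N(r+1) = T^(r+1) + T N(r), which (r + 1) T^r solves. The condition \<open>r < d\<close> stops at
  order 1, so all operator norms involved are nonnegative.\<close>

lemma op_norm_moment_bound:
  assumes L2: "\<And>k. k \<in> {1..<d} \<Longrightarrow> op_norm_L2 k f \<le> real CARD('n) powr (- (real d - real k) / 2)"
    and top: "\<And>\<theta>. \<theta> \<in> sphere 0 1 \<Longrightarrow> op_norm d f \<theta> \<le> 1"
    and r: "r < d"
  shows "(\<integral>x. op_norm (d - r) f x ^ (2 * m) \<partial>sphere_uniform) \<le> ((real r + 1) * T ^ r) ^ (2 * m)"
  using r
proof (induction r)
  case 0
  have nn: "0 \<le> op_norm d f x" for x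
    using 0 op_norm_Suc_nonneg[of "d - 1" f x] by simp
  have "(\<integral>x. op_norm d f x ^ (2 * m) \<partial>sphere_uniform) \<le> (\<integral>x. 1 \<partial>(sphere_uniform :: (real^'n) measure))"
  proof (rule integral_mono)
    show "integrable sphere_uniform (\<lambda>x. op_norm d f x ^ (2 * m))"
      by (intro integrable_sphere_uniform_continuous continuous_intros
          continuous_on_subset[OF continuous_on_op_norm[OF smooth U(1)] U(2)]) auto
  qed (use nn top in \<open>auto intro: power_le_one\<close>)
  then show ?case by (simp add: measure_sphere_uniform_sphere)
next
  case (Suc r)
  define k where "k = d - Suc r"
  have k: "k < d" "k \<ge> 1" "Suc k = d - r" "real d - real k = real (Suc r)"
    using Suc.prems by (auto simp: k_def)
  have n: "real CARD('n) \<ge> 2" using card by simp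
  \<comment> \<open>T^2 is at least 1/(n - 1) because pi/2 and m are at least 1, so the powers of n
    in the hypothesis become powers of T.\<close>
  have base: "real CARD('n) powr (- 1 / 2) \<le> T"
  proof (rule power2_le_imp_le)
    have "(real CARD('n) powr (- 1 / 2))\<^sup>2 = real CARD('n) powr (- 1 / 2 + - 1 / 2)"
      by (simp only: powr_add power2_eq_square)
    also have "\<dots> = 1 / real CARD('n)"
      using n by (simp add: powr_minus_divide)
    also have "\<dots> \<le> 1 / (real CARD('n) - 1)" using n by (intro divide_left_mono) auto
    also have "\<dots> \<le> (pi / 2)\<^sup>2 * real m / (real CARD('n) - 1)"
    proof (intro divide_right_mono)
      have "1 ^ 2 \<le> (pi / 2)\<^sup>2" using pi_ge_two by (intro power_mono) auto
      then show "1 \<le> (pi / 2)\<^sup>2 * real m"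
        using mult_mono[of 1 "(pi / 2)\<^sup>2" 1 "real m"] m by simp
    qed (use n in auto)
    finally show "(real CARD('n) powr (- 1 / 2))\<^sup>2 \<le> T\<^sup>2" by (simp add: T(2))
  qed (use T in simp)
  have "op_norm_L2 k f \<le> real CARD('n) powr (- (real d - real k) / 2)"
    using k by (intro L2) auto
  also have "\<dots> = (real CARD('n) powr (- 1 / 2)) ^ Suc r"
  proof -
    have "- (real d - real k) / 2 = - 1 / 2 * real (Suc r)" unfolding k(4) by (simp only: minus_divide_left mult_minus1 times_divide_eq_left)
    then show ?thesis
      using n by (simp only: powr_powr[symmetric]) (subst powr_realpow, auto)
  qed
  also have "\<dots> \<le> T ^ Suc r" by (intro power_mono base) auto
  finally have c: "op_norm_L2 k f \<le> T ^ Suc r" .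
  have "(\<integral>x. op_norm k f x ^ (2 * m) \<partial>sphere_uniform) \<le> (T ^ Suc r + T * ((real r + 1) * T ^ r)) ^ (2 * m)"
  proof (rule op_norm_moment_step[OF k(1) _ _ _ c])
    show "(\<integral>x. op_norm (Suc k) f x ^ (2 * m) \<partial>sphere_uniform) \<le> ((real r + 1) * T ^ r) ^ (2 * m)"
      using Suc by (simp add: k(3))
    show "0 \<le> op_norm k f x" for x
      using k(2) op_norm_Suc_nonneg[of "k - 1" f x] by simp
  qed (use T in \<open>auto intro: mult_pos_pos add_nonneg_pos\<close>)
  also have "T ^ Suc r + T * ((real r + 1) * T ^ r) = (real (Suc r) + 1) * T ^ Suc r"
    by (simp add: algebra_simps)
  finally show ?case by (simp add: k_def)
qed

text \<open>The last step, from order 1 to order 0, applies to \<open>f\<close> directly. Since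
  \<open>f\<close> has mean zero, no constant is added, and the factor remains
  \<open>d\<close>.\<close>

lemma moment_bound:
  assumes d: "d \<ge> 1" and mean: "(\<integral>x. f x \<partial>sphere_uniform) = 0"
    and L2: "\<And>k. k \<in> {1..<d} \<Longrightarrow> op_norm_L2 k f \<le> real CARD('n) powr (- (real d - real k) / 2)"
    and top: "\<And>\<theta>. \<theta> \<in> sphere 0 1 \<Longrightarrow> op_norm d f \<theta> \<le> 1"
  shows "(\<integral>x. f x ^ (2 * m) \<partial>sphere_uniform) \<le> (real d * T ^ d) ^ (2 * m)"
proof -
  have form0: "deriv_form 0 f x v = f x" for x v
    by (simp add: deriv_form_def)
  have der: "(f has_derivative (\<lambda>w. form_gradient 0 f x (\<lambda>_. 0) \<bullet> w)) (at x)" if "x \<in> sphere 0 1" for x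
    using deriv_form_has_derivative[OF smooth U(1), of 0 x "\<lambda>_. 0"] d U(2) that by (auto simp: form0)
  have cont: "continuous_on (sphere 0 1) (\<lambda>x. form_gradient 0 f x (\<lambda>_. 0))"
    using d by (intro continuous_on_subset[OF continuous_on_form_gradient[OF smooth U(1)] U(2)]) auto
  have le: "norm (form_gradient 0 f x (\<lambda>_. 0)) \<le> op_norm 1 f x" for x
    using norm_form_gradient_le[of 0 "\<lambda>_. 0" f x] by simp
  have "(\<integral>x. op_norm 1 f x ^ (2 * m) \<partial>sphere_uniform) \<le> (real d * T ^ (d - 1)) ^ (2 * m)"
    using op_norm_moment_bound[OF L2 top, of "d - 1"] d by (simp add: of_nat_diff)
  from gradient_moment_step[OF der cont le d this]
  have "(\<integral>x. f x ^ (2 * m) \<partial>sphere_uniform) \<le> (T * (real d * T ^ (d - 1))) ^ (2 * m)"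
    by (simp add: mean)
  also have "T * (real d * T ^ (d - 1)) = real d * T ^ d"
    using d by (cases d) auto
  finally show ?thesis .
qed

end

section \<open>Exponential moments\<close>

text \<open>In the induction the left side grows by the factor (k + 1) (1 + 1/(k+1))^(k+1), which is
  at most e (k + 1). It is what makes the exponential series geometric.\<close>

lemma Suc_power_le_exp_fact: "(real k + 1) ^ k \<le> exp (real k) * fact k"
proof (induction k)
  case (Suc k)
  have "1 + 1 / (real k + 1) \<le> exp (1 / (real k + 1))" by (rule exp_ge_add_one_self)
  then have "(1 + 1 / (real k + 1)) ^ Suc k \<le> exp (1 / (real k + 1)) ^ Suc k"
    by (intro power_mono) (auto intro: add_nonneg_nonneg)
  also have "\<dots> = exp 1" by (simp add: exp_of_nat_mult[symmetric] del: power_Suc)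
  finally have "(1 + 1 / (real k + 1)) ^ Suc k * (real k + 1) ^ Suc k \<le> exp 1 * (real k + 1) ^ Suc k"
    by (intro mult_right_mono) auto
  moreover have "(1 + 1 / (real k + 1)) ^ Suc k * (real k + 1) ^ Suc k = (real (Suc k) + 1) ^ Suc k"
    unfolding power_mult_distrib[symmetric] by (rule arg_cong[where f = "\<lambda>x. x ^ Suc k"]) (simp add: field_simps)
  ultimately have "(real (Suc k) + 1) ^ Suc k \<le> exp 1 * (real k + 1) * (real k + 1) ^ k"
    by (simp only: mult.assoc power_Suc)
  also have "\<dots> \<le> exp 1 * (real k + 1) * (exp (real k) * fact k)"
    by (intro mult_left_mono Suc) auto
  also have "\<dots> = exp (real (Suc k)) * fact (Suc k)"
    by (simp add: exp_add algebra_simps)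
  finally show ?case .
qed simp

text \<open>It allows the factor d^2 in the square of the moment bound to be absorbed into a d-th
  power.\<close>

lemma square_le_three_power: "(real d)\<^sup>2 \<le> 3 ^ d"
proof (induction d rule: less_induct)
  case (less d)
  show ?case
  proof (cases "d < 3")
    case True
    then have "d = 0 \<or> d = 1 \<or> d = 2" by auto
    then show ?thesis by auto
  next
    case False
    define e where "e = d - 1"
    have e: "d = Suc e" "e \<ge> 2" using False by (auto simp: e_def)
    have "(real e)\<^sup>2 \<le> 3 ^ e" by (rule less) (simp add: e)
    moreover have "(real d)\<^sup>2 \<le> 3 * (real e)\<^sup>2"
    proof -
      have "real e \<ge> 2" using e by simp
      then have "real e * real e \<ge> 2 * real e" by (intro mult_right_mono) auto
      moreover have "(real d)\<^sup>2 = real e * real e + 2 * real e + 1"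
        by (simp add: e(1) power2_eq_square algebra_simps)
      ultimately show ?thesis using \<open>real e \<ge> 2\<close> unfolding power2_eq_square[of "real e"] by linarith
    qed
    ultimately show ?thesis by (simp add: e(1))
  qed
qed

text \<open>Monotonicity of L^r norms up to r = 2m, from the pointwise inequality z^r <= \<alpha>
  z^(2m) + 1 - \<alpha> with \<alpha> = r/(2m) and z = |g|/A. It reaches the fractional exponents
  2k/d.\<close>

lemma powr_moment_le:
  fixes g :: "'a::euclidean_space \<Rightarrow> real"
  assumes g: "continuous_on (sphere 0 1) g" and A: "A > 0" and m: "m \<ge> 1"
    and r: "r > 0" "r \<le> 2 * real m"
    and moment: "(\<integral>x. g x ^ (2 * m) \<partial>sphere_uniform) \<le> A ^ (2 * m)"
  shows "(\<integral>x. \<bar>g x\<bar> powr r \<partial>sphere_uniform) \<le> A powr r"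
proof -
  define \<alpha> where "\<alpha> = r / (2 * real m)"
  have \<alpha>: "0 < \<alpha>" "\<alpha> \<le> 1" using r m by (auto simp: \<alpha>_def)
  have ig: "integrable sphere_uniform (\<lambda>x. g x ^ (2 * m))"
    by (intro integrable_sphere_uniform_continuous continuous_intros g)
  have pt: "\<bar>y\<bar> powr r \<le> A powr r * (1 - \<alpha> + \<alpha> * (y ^ (2 * m) / A ^ (2 * m)))" for y
  proof (cases "y = 0")
    case True
    then show ?thesis using \<alpha> m by (simp add: zero_power)
  next
    case False
    define z where "z = \<bar>y\<bar> / A"
    have z: "z > 0" using False A by (simp add: z_def)
    have "(z ^ (2 * m)) powr \<alpha> * 1 powr (1 - \<alpha>) \<le> \<alpha> * z ^ (2 * m) + (1 - \<alpha>) * 1"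
      using \<alpha> z by (intro Youngs_inequality_0) auto
    moreover have "(z ^ (2 * m)) powr \<alpha> = z powr r"
      using z m by (simp add: powr_realpow[symmetric] powr_powr \<alpha>_def)
    moreover have "\<bar>y\<bar> powr r = A powr r * z powr r"
      using A z by (simp add: z_def powr_divide)
    moreover have "z ^ (2 * m) = y ^ (2 * m) / A ^ (2 * m)"
      by (simp add: z_def power_divide power_even_abs)
    ultimately have "z powr r \<le> 1 - \<alpha> + \<alpha> * (y ^ (2 * m) / A ^ (2 * m))" by simp
    then show ?thesis
      unfolding \<open>\<bar>y\<bar> powr r = A powr r * z powr r\<close> by (intro mult_left_mono) auto
  qed
  have "(\<integral>x. \<bar>g x\<bar> powr r \<partial>sphere_uniform)
      \<le> (\<integral>x. A powr r * (1 - \<alpha> + \<alpha> / A ^ (2 * m) * g x ^ (2 * m)) \<partial>sphere_uniform)"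
  proof (rule integral_mono)
    show "integrable sphere_uniform (\<lambda>x. \<bar>g x\<bar> powr r)"
      by (intro integrable_sphere_uniform_continuous continuous_on_powr' continuous_intros g) (use r in auto)
    show "integrable sphere_uniform (\<lambda>x. A powr r * (1 - \<alpha> + \<alpha> / A ^ (2 * m) * g x ^ (2 * m)))"
      using ig by (intro integrable_mult_right Bochner_Integration.integrable_add) auto
  qed (use pt in auto)
  also have "\<dots> = A powr r * (1 - \<alpha> + \<alpha> / A ^ (2 * m) * (\<integral>x. g x ^ (2 * m) \<partial>sphere_uniform))"
    using ig by (simp add: measure_sphere_uniform_sphere)
  also have "\<dots> \<le> A powr r * (1 - \<alpha> + \<alpha> / A ^ (2 * m) * A ^ (2 * m))"
    using \<alpha> A by (intro mult_left_mono add_left_mono moment) auto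
  also have "\<dots> = A powr r" using A by simp
  finally show ?thesis .
qed

text \<open>The exponent \<open>m\<close> is \<open>\<lceil>k / d\<rceil>\<close>, so that \<open>2 * m\<close> is the least even integer above \<open>2 * k / d\<close>.\<close>

lemma moment_constant_le:
  fixes q :: real
  assumes d: "d \<ge> 1" and k: "k \<ge> 1" and q: "q > 0"
  defines "m \<equiv> (k + d - 1) div d"
  shows "(real d)\<^sup>2 * ((pi / 2)\<^sup>2 * real m / q) ^ d \<le> (4 * (real k + 1) / q) ^ d"
proof -
  have "pi\<^sup>2 \<le> (16 / 5)\<^sup>2" using pi_approx pi_gt_zero by (intro power_mono) auto
  then have pi2: "(pi / 2)\<^sup>2 \<le> 64 / 25" by (simp add: power2_eq_square)
  show ?thesis
  \<comment> \<open>For \<open>d = 1\<close> the exponent \<open>m\<close> equals \<open>k\<close>,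
    and (pi/2)^2 < 4 is enough. For larger \<open>d\<close> the inequality 2m <= k + 1 gains a
    factor of about 2, which pays for the 3 that absorbs d^2: 3 * 64/25 is less than 8.\<close>
  proof (cases "d = 1")
    case True
    have "(pi / 2)\<^sup>2 * real k \<le> 4 * (real k + 1)"
      using mult_right_mono[OF pi2 of_nat_0_le_iff[of k]] by simp
    then show ?thesis using q by (simp add: m_def True divide_right_mono)
  next
    case False
    then have d2: "d \<ge> 2" using d by simp
    have "m * d \<le> k + d - 1" by (simp add: m_def)
    then have "m * d < k + d" using k d by linarith
    have "2 * m \<le> k + 1"
    proof (cases m)
      case (Suc j)
      have "j * 2 \<le> j * d" using d2 by (rule mult_le_mono2)
      moreover have "j * d < k" using \<open>m * d < k + d\<close> Suc by simp
      ultimately show ?thesis using Suc by linarith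
    qed simp
    then have m2: "2 * real m \<le> real k + 1" by (simp flip: of_nat_Suc)
    have "3 * ((pi / 2)\<^sup>2 * real m) \<le> 3 * (64 / 25 * real m)"
      by (intro mult_left_mono mult_right_mono pi2) auto
    also have "\<dots> \<le> 4 * (real k + 1)" using m2 by simp
    finally have le: "3 * ((pi / 2)\<^sup>2 * real m) / q \<le> 4 * (real k + 1) / q"
      using q by (intro divide_right_mono) auto
    have "(real d)\<^sup>2 * ((pi / 2)\<^sup>2 * real m / q) ^ d \<le> 3 ^ d * ((pi / 2)\<^sup>2 * real m / q) ^ d"
      using q by (intro mult_right_mono square_le_three_power) auto
    also have "\<dots> = (3 * ((pi / 2)\<^sup>2 * real m) / q) ^ d"
      by (simp add: power_mult_distrib[symmetric])
    also have "\<dots> \<le> (4 * (real k + 1) / q) ^ d" using q le by (intro power_mono) auto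
    finally show ?thesis .
  qed
qed

theorem theorem1p13:
  fixes f :: "real^'n \<Rightarrow> real" and U :: "(real^'n) set" and d :: nat
  assumes "CARD('n) \<ge> 2" and "d \<ge> 1"
    and "open U" and "sphere 0 1 \<subseteq> U" and "C_smooth_on d f U"
    and "(\<integral>x. f x \<partial>sphere_uniform) = 0"
    and "\<And>k. k \<in> {1..<d} \<Longrightarrow>
           op_norm_L2 k f \<le> real CARD('n) powr (- (real d - real k) / 2)"
    and "\<And>\<theta>. \<theta> \<in> sphere 0 1 \<Longrightarrow> op_norm d f \<theta> \<le> 1"
  shows "(\<integral>\<^sup>+x. ennreal (exp ((real CARD('n) - 1) * \<bar>f x\<bar> powr (2 / real d) / (8 * exp 1)))
            \<partial>sphere_uniform) \<le> 2"
proof -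
  define q where "q = real CARD('n) - 1"
  have q: "q \<ge> 1" using assms(1) by (simp add: q_def)
  have cf: "continuous_on (sphere 0 1) f"
    using continuous_on_subset[OF continuous_on_partials[OF assms(5,3), of "[]"] assms(4)] by simp
  define w where "w x = \<bar>f x\<bar> powr (2 / real d)" for x
  have cw: "continuous_on (sphere 0 1) w"
    unfolding w_def by (intro continuous_on_powr' continuous_intros cf) (use assms(2) in auto)
  have w0: "w x \<ge> 0" for x by (simp add: w_def)
  have moments: "(\<integral>x. w x ^ k \<partial>sphere_uniform) \<le> (4 * (real k + 1) / q) ^ k" for k
  \<comment> \<open>The case is separate because the exponent \<open>m\<close> chosen below would be
    0.\<close>
  proof (cases "k = 0")
    case True
    then show ?thesis by (simp add: measure_sphere_uniform_sphere)
  next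
    case False
    then have k: "k \<ge> 1" by simp
    define m where "m = (k + d - 1) div d"
    have m: "m \<ge> 1" using k assms(2) by (simp add: m_def div_greater_zero_iff Suc_le_eq)
    have mk: "real k \<le> real m * real d"
    proof -
      have "k + d - 1 < (m + 1) * d"
        using assms(2) dividend_less_div_times[of d "k + d - 1"] by (simp add: m_def)
      then have "k \<le> m * d" using assms(2) by simp
      then show ?thesis by (metis of_nat_le_iff of_nat_mult)
    qed
    define T where "T = sqrt ((pi / 2)\<^sup>2 * real m / q)"
    have T: "T > 0" "T\<^sup>2 = (pi / 2)\<^sup>2 * real m / (real CARD('n) - 1)"
      using q m by (simp_all add: T_def q_def[symmetric])
    define A where "A = real d * T ^ d"
    have A: "A > 0" using T assms(2) by (simp add: A_def)
    have "(\<integral>x. f x ^ (2 * m) \<partial>sphere_uniform) \<le> A ^ (2 * m)"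
      unfolding A_def by (rule moment_bound[OF assms(1,5,3,4) m T assms(2,6,7,8)])
    then have "(\<integral>x. \<bar>f x\<bar> powr (2 * real k / real d) \<partial>sphere_uniform) \<le> A powr (2 * real k / real d)"
      using assms(2) k mk by (intro powr_moment_le[OF cf A m]) (auto simp: field_simps)
    also have "A powr (2 * real k / real d) = (A\<^sup>2) powr (real k / real d)"
    proof -
      have "A\<^sup>2 = A powr 2" using A by simp
      then have "(A\<^sup>2) powr (real k / real d) = A powr (2 * (real k / real d))" by (simp only: powr_powr)
      then show ?thesis by simp
    qed
    also have "\<dots> \<le> ((4 * (real k + 1) / q) ^ d) powr (real k / real d)"
    proof (rule powr_mono2)
      have "A\<^sup>2 = (real d)\<^sup>2 * (T\<^sup>2) ^ d"
        by (simp add: A_def power_mult_distrib power_mult[symmetric] mult.commute)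
      then show "A\<^sup>2 \<le> (4 * (real k + 1) / q) ^ d"
        using moment_constant_le[OF assms(2) k, of q] q by (simp add: T(2) m_def q_def)
    qed (use k in auto)
    also have "\<dots> = (4 * (real k + 1) / q) ^ k"
      using q assms(2) by (simp add: powr_realpow[symmetric] powr_powr)
    also have "(\<integral>x. \<bar>f x\<bar> powr (2 * real k / real d) \<partial>sphere_uniform) = (\<integral>x. w x ^ k \<partial>sphere_uniform)"
    proof -
      have "w x ^ k = \<bar>f x\<bar> powr (2 * real k / real d)" for x
        using k by (cases "f x = 0") (simp_all add: w_def powr_powr flip: powr_realpow)
      then show ?thesis by simp
    qed
    finally show ?thesis .
  qed
  define a where "a = q / (8 * exp 1)"
  have a: "a > 0" using q by (simp add: a_def)
  have term_le: "(\<integral>\<^sup>+x. ennreal ((a * w x) ^ k / fact k) \<partial>sphere_uniform) \<le> ennreal ((1 / 2) ^ k)" for k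
  proof -
    have "integrable sphere_uniform (\<lambda>x. (a * w x) ^ k / fact k)"
      by (intro integrable_sphere_uniform_continuous continuous_intros cw) auto
    then have "(\<integral>\<^sup>+x. ennreal ((a * w x) ^ k / fact k) \<partial>sphere_uniform)
        = ennreal (\<integral>x. (a * w x) ^ k / fact k \<partial>sphere_uniform)"
      using a w0 by (intro nn_integral_eq_integral) auto
    also have "(\<integral>x. (a * w x) ^ k / fact k \<partial>sphere_uniform) = a ^ k / fact k * (\<integral>x. w x ^ k \<partial>sphere_uniform)"
      by (simp add: power_mult_distrib)
    also have "\<dots> \<le> a ^ k / fact k * (4 * (real k + 1) / q) ^ k"
      using a by (intro mult_left_mono moments) auto
    also have "\<dots> = (a * (4 * (real k + 1) / q)) ^ k / fact k"
      by (simp only: power_mult_distrib[of a] times_divide_eq_left)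
    \<comment> \<open>The dimension cancels here. The power of e is cancelled by
      \<open>Suc_power_le_exp_fact\<close>, and the remaining factor 1/2 is the ratio of the
      geometric series.\<close>
    also have "a * (4 * (real k + 1) / q) = (real k + 1) / (2 * exp 1)"
      using q by (simp add: a_def frac_eq_eq)
    also have "((real k + 1) / (2 * exp 1)) ^ k / fact k = (real k + 1) ^ k / (exp (real k) * fact k) * (1 / 2) ^ k"
      by (simp add: power_divide power_mult_distrib exp_of_nat_mult[symmetric])
    also have "\<dots> \<le> 1 * (1 / 2) ^ k"
      using Suc_power_le_exp_fact[of k] by (intro mult_right_mono) auto
    finally show ?thesis by (simp add: ennreal_leI)
  qed
  have "(\<integral>\<^sup>+x. ennreal (exp (q * \<bar>f x\<bar> powr (2 / real d) / (8 * exp 1))) \<partial>sphere_uniform)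
      = (\<integral>\<^sup>+x. (\<Sum>k. ennreal ((a * w x) ^ k / fact k)) \<partial>sphere_uniform)"
  proof (rule nn_integral_cong)
    fix x
    have sums: "(\<lambda>k. (a * w x) ^ k / fact k) sums exp (a * w x)"
      using exp_converges[of "a * w x"] by (simp add: divide_inverse mult.commute)
    then have "(\<Sum>k. ennreal ((a * w x) ^ k / fact k)) = ennreal (exp (a * w x))"
      using a w0 by (subst suminf_ennreal2) (auto simp: sums_iff)
    then show "ennreal (exp (q * \<bar>f x\<bar> powr (2 / real d) / (8 * exp 1))) = (\<Sum>k. ennreal ((a * w x) ^ k / fact k))"
      by (simp add: a_def w_def)
  qed
  also have "\<dots> = (\<Sum>k. \<integral>\<^sup>+x. ennreal ((a * w x) ^ k / fact k) \<partial>sphere_uniform)"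
  proof (rule nn_integral_suminf)
    fix k
    have [measurable]: "w \<in> borel_measurable sphere_uniform"
      by (rule borel_measurable_continuous_on_sphere[OF cw])
    show "(\<lambda>x. ennreal ((a * w x) ^ k / fact k)) \<in> borel_measurable sphere_uniform" by measurable
  qed
  also have "\<dots> \<le> (\<Sum>k. ennreal ((1 / 2) ^ k))"
    by (intro suminf_le term_le summableI)
  also have "\<dots> = ennreal (\<Sum>k. (1 / 2) ^ k)"
    by (rule suminf_ennreal2) auto
  also have "\<dots> = 2" by (simp add: suminf_geometric)
  finally show ?thesis by (simp add: q_def)
qed

end
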